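(* Let $M=(E,\mathcal{I})$ be a matroid with $\operatorname{rank}(M)\ge 2$. For any $e\in E$, the basis generating polynomial $f_M$ satisfies $\mathrm{HRR}_1$ on $\operatorname{relint}(H_e)$ if and only if $e$ is not a coloop of $M$. Here $H_e=\{x\in\mathbb{R}_{\ge0}^E: x_e=0\}$, so that $\operatorname{relint}(H_e)=\{x\in\mathbb{R}^E: x_e=0,\ x_i>0\text{ for all }i\ne e\}$.
   Context: Let $M$ be a matroid of rank $d$ on the finite set $E$ with basis set $\mathcal{B}$. Its basis generating polynomial is $f_M=\sum_{B\in\mathcal{B}}\prod_{e\in B}x_e\in\mathbb{R}[x_e:e\in E]$. A coloop is an element contained in every basis. Let $S=\mathbb{R}[\partial_e: e\in E]$ act on $\mathbb{R}[x_e:e\in E]$ with $\partial_e=\partial/\partial x_e$, let $\operatorname{Ann}(f_M)=\{\xi\in S:\xi(f_M)=0\}$, and let $A(M)=S/\operatorname{Ann}(f_M)=\bigoplus_{i=0}^d A^i(M)$, graded by degree of differential forms. The isomorphism $\deg:A^d(M)\to\mathbb{R}$ is $\xi\mapsto\xi(f_M)$. For $l\in A^1(M)$ and an integer $0\le k\le d/2$: the Hodge–Riemann form is $Q_l^k(\xi_1,\xi_2)=(-1)^k\deg(\xi_1\xi_2 l^{d-2k})$ on $A^k(M)$, and the primitive subspace is $P_l^k=\{\xi\in A^k(M): l^{d-2k+1}\xi=0\}$. $A(M)$ (equivalently $f_M$) satisfies $\mathrm{HRR}_k$ with respect to $l$ if $Q_l^k$ is positive definite on $P_l^k$. For $a\in\mathbb{R}^E$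 put $l_a=\sum_{e\in E}a_e\partial_e$; "$f_M$ satisfies $\mathrm{HRR}_1$ on a set $\Omega\subseteq\mathbb{R}^E$" means that $\mathrm{HRR}_1$ holds with respect to $l_a$ for every $a\in\Omega$. *)

theory Defs
  imports
    "HOL-Analysis.Function_Topology"
    "HOL-Algebra.QuotRing"
    "HOL-Library.Poly_Mapping"
begin

section \<open>Matroids\<close>

locale matroid =
  fixes E :: "'a set" and \<I> :: "'a set set"
  assumes finite_ground: "finite E"
    and indep_subset_ground: "X \<in> \<I> \<Longrightarrow> X \<subseteq> E"
    and indep_empty: "{} \<in> \<I>"
    and indep_subset: "X \<in> \<I> \<Longrightarrow> Y \<subseteq> X \<Longrightarrow> Y \<in> \<I>"
    and indep_augment: "X \<in> \<I> \<Longrightarrow> Y \<in> \<I> \<Longrightarrow> card X < card Y \<Longrightarrow>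
          \<exists>y \<in> Y - X. insert y X \<in> \<I>"

definition bases :: "'a set set \<Rightarrow> 'a set set" where
  "bases \<I> = {B \<in> \<I>. \<forall>X \<in> \<I>. B \<subseteq> X \<longrightarrow> X = B}"

definition matroid_rank :: "'a set set \<Rightarrow> nat" where
  "matroid_rank \<I> = Max (card ` \<I>)"

definition coloop :: "'a set set \<Rightarrow> 'a \<Rightarrow> bool" where
  "coloop \<I> e \<longleftrightarrow> (\<forall>B \<in> bases \<I>. e \<in> B)"


section \<open>Real polynomials and constant-coefficient differential operators\<close>

text \<open>
  A polynomial maps exponent vectors to coefficients, both finitely supported; the ring
  operations are the convolution operations of \<^theory>\<open>HOL-Library.Poly_Mapping\<close>. The same type
  serves for the polynomials in the variables \<open>x\<^sub>e\<close> and for the operators in the variables \<open>\<partial>\<^sub>e\<close>.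
\<close>

type_synonym 'a rpoly = "('a \<Rightarrow>\<^sub>0 nat) \<Rightarrow>\<^sub>0 real"

definition Var :: "'a \<Rightarrow> 'a rpoly" where
  "Var e = Poly_Mapping.single (Poly_Mapping.single e 1) 1"

definition Const :: "real \<Rightarrow> 'a rpoly" where
  "Const c = Poly_Mapping.single 0 c"

definition homogeneous :: "nat \<Rightarrow> 'a rpoly \<Rightarrow> bool" where
  "homogeneous k p \<longleftrightarrow>
     (\<forall>m \<in> Poly_Mapping.keys p. (\<Sum>e \<in> Poly_Mapping.keys m. Poly_Mapping.lookup m e) = k)"

definition basis_gen_poly :: "'a set set \<Rightarrow> 'a rpoly" where
  "basis_gen_poly \<I> = (\<Sum>B \<in> bases \<I>. \<Prod>e \<in> B. Var e)"

text \<open>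
  The truncated subtraction of exponents is harmless: if \<open>e\<close> does not occur in the monomial \<open>m\<close>,
  the coefficient vanishes.
\<close>

definition pdiff :: "'a \<Rightarrow> 'a rpoly \<Rightarrow> 'a rpoly" where
  "pdiff e p = (\<Sum>m \<in> Poly_Mapping.keys p.
     Poly_Mapping.single (m - Poly_Mapping.single e 1)
       (real (Poly_Mapping.lookup m e) * Poly_Mapping.lookup p m))"

text \<open>
  The composition of all \<open>\<partial>\<^sub>e\<close>, each iterated as often as the exponent of \<open>e\<close> in \<open>m\<close> says. The
  order of composition is irrelevant, see \<open>pdiff_comp_fun_commute\<close> below.
\<close>

definition pdiff_monom :: "('a \<Rightarrow>\<^sub>0 nat) \<Rightarrow> 'a rpoly \<Rightarrow> 'a rpoly" where
  "pdiff_monom m p =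
     Finite_Set.fold (\<lambda>e. pdiff e ^^ Poly_Mapping.lookup m e) p (Poly_Mapping.keys m)"

definition diff_act :: "'a rpoly \<Rightarrow> 'a rpoly \<Rightarrow> 'a rpoly" where
  "diff_act \<xi> p = (\<Sum>m \<in> Poly_Mapping.keys \<xi>.
     Const (Poly_Mapping.lookup \<xi> m) * pdiff_monom m p)"

definition diff_ring :: "'a set \<Rightarrow> 'a rpoly ring" where
  "diff_ring E =
     \<lparr>carrier = {\<xi>. \<forall>m \<in> Poly_Mapping.keys \<xi>. Poly_Mapping.keys m \<subseteq> E},
      mult = (*), one = 1, zero = 0, add = (+)\<rparr>"


section \<open>The graded algebra of a polynomial and the Hodge--Riemann relations\<close>

definition Ann :: "'a set \<Rightarrow> 'a rpoly \<Rightarrow> 'a rpoly set" where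
  "Ann E f = {\<xi> \<in> carrier (diff_ring E). diff_act \<xi> f = 0}"

definition alg :: "'a set \<Rightarrow> 'a rpoly \<Rightarrow> 'a rpoly set ring" where
  "alg E f = diff_ring E Quot Ann E f"

definition alg_class :: "'a set \<Rightarrow> 'a rpoly \<Rightarrow> 'a rpoly \<Rightarrow> 'a rpoly set" where
  "alg_class E f \<xi> = Ann E f +>\<^bsub>diff_ring E\<^esub> \<xi>"

definition alg_comp :: "'a set \<Rightarrow> 'a rpoly \<Rightarrow> nat \<Rightarrow> 'a rpoly set set" where
  "alg_comp E f k = alg_class E f ` {\<xi> \<in> carrier (diff_ring E). homogeneous k \<xi>}"

text \<open>
  All representatives \<open>\<xi>\<close> of a class give the same \<open>\<xi>(f)\<close>. For a class of degree \<open>d\<close>, where \<open>f\<close>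
  is homogeneous of degree \<open>d\<close>, this is a constant polynomial, whose value is its coefficient at
  the exponent \<open>0\<close>.
\<close>

definition alg_deg :: "'a rpoly \<Rightarrow> 'a rpoly set \<Rightarrow> real" where
  "alg_deg f X = Poly_Mapping.lookup (the_elem ((\<lambda>\<xi>. diff_act \<xi> f) ` X)) 0"

text \<open>
  In the following, \<open>f\<close> is homogeneous of degree \<open>d\<close>, \<open>2 * k \<le> d\<close> (so that the subtraction is
  exact), and \<open>L \<in> alg_comp E f 1\<close>.
\<close>

definition HR_form ::
  "'a set \<Rightarrow> 'a rpoly \<Rightarrow> nat \<Rightarrow> nat \<Rightarrow> 'a rpoly set \<Rightarrow> 'a rpoly set \<Rightarrow> 'a rpoly set \<Rightarrow> real" where
  "HR_form E f d k L X Y =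
     (- 1) ^ k * alg_deg f (X \<otimes>\<^bsub>alg E f\<^esub> Y \<otimes>\<^bsub>alg E f\<^esub> (L [^]\<^bsub>alg E f\<^esub> (d - 2 * k)))"

definition primitive_space ::
  "'a set \<Rightarrow> 'a rpoly \<Rightarrow> nat \<Rightarrow> nat \<Rightarrow> 'a rpoly set \<Rightarrow> 'a rpoly set set" where
  "primitive_space E f d k L =
     {X \<in> alg_comp E f k. L [^]\<^bsub>alg E f\<^esub> (d - 2 * k + 1) \<otimes>\<^bsub>alg E f\<^esub> X = \<zero>\<^bsub>alg E f\<^esub>}"

definition HRR :: "'a set \<Rightarrow> 'a rpoly \<Rightarrow> nat \<Rightarrow> nat \<Rightarrow> 'a rpoly set \<Rightarrow> bool" where
  "HRR E f d k L \<longleftrightarrow>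
     (\<forall>X \<in> primitive_space E f d k L. X \<noteq> \<zero>\<^bsub>alg E f\<^esub> \<longrightarrow> HR_form E f d k L X X > 0)"

definition linear_form :: "'a set \<Rightarrow> ('a \<Rightarrow> real) \<Rightarrow> 'a rpoly" where
  "linear_form E a = (\<Sum>e \<in> E. Const (a e) * Var e)"

definition HRR_on :: "'a set \<Rightarrow> 'a rpoly \<Rightarrow> nat \<Rightarrow> nat \<Rightarrow> ('a \<Rightarrow> real) set \<Rightarrow> bool" where
  "HRR_on E f d k \<Omega> \<longleftrightarrow> (\<forall>a \<in> \<Omega>. HRR E f d k (alg_class E f (linear_form E a)))"


section \<open>Relative interior in a coordinate space\<close>

text \<open>
  The space of real vectors indexed by \<open>E\<close> is \<open>E \<rightarrow>\<^sub>E UNIV\<close> with the product topology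
  \<open>powertop_real E\<close>. The type of all functions carries no vector space structure in the
  library, hence the affine hull is written out.
\<close>

definition affine_hull_on :: "'a set \<Rightarrow> ('a \<Rightarrow> real) set \<Rightarrow> ('a \<Rightarrow> real) set" where
  "affine_hull_on E C = {x \<in> E \<rightarrow>\<^sub>E UNIV. \<exists>F c. finite F \<and> F \<subseteq> C \<and> sum c F = 1 \<and>
     (\<forall>i \<in> E. x i = (\<Sum>v \<in> F. c v * v i))}"

definition relint_on :: "'a set \<Rightarrow> ('a \<Rightarrow> real) set \<Rightarrow> ('a \<Rightarrow> real) set" where
  "relint_on E C = subtopology (powertop_real E) (affine_hull_on E C) interior_of C"

definition orthant_facet :: "'a set \<Rightarrow> 'a \<Rightarrow> ('a \<Rightarrow> real) set" where
  "orthant_facet E e = {x \<in> E \<rightarrow>\<^sub>E UNIV. (\<forall>i \<in> E. 0 \<le> x i) \<and> x e = 0}"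

lemma affine_hull_orthant_facet:
  assumes "finite E" "e \<in> E"
  shows "affine_hull_on E (orthant_facet E e) = {x \<in> E \<rightarrow>\<^sub>E UNIV. x e = 0}"
proof (intro equalityI subsetI)
  fix x assume "x \<in> affine_hull_on E (orthant_facet E e)"
  then obtain F c where x: "x \<in> E \<rightarrow>\<^sub>E UNIV" and F: "F \<subseteq> orthant_facet E e"
    and eq: "\<forall>i \<in> E. x i = (\<Sum>v \<in> F. c v * v i)"
    unfolding affine_hull_on_def by blast
  have "x e = (\<Sum>v \<in> F. c v * v e)" using eq assms by blast
  also have "\<dots> = 0" by (rule sum.neutral) (use F in \<open>auto simp: orthant_facet_def\<close>)
  finally show "x \<in> {x \<in> E \<rightarrow>\<^sub>E UNIV. x e = 0}" using x by simp
next
  fix x assume "x \<in> {x \<in> E \<rightarrow>\<^sub>E (UNIV :: real set). x e = 0}"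
  then have x: "x \<in> E \<rightarrow>\<^sub>E UNIV" and xe: "x e = 0" by auto
  define p where "p = restrict (\<lambda>i. \<bar>x i\<bar>) E"
  define q where "q = restrict (\<lambda>i. (\<bar>x i\<bar> - x i) / 2) E"
  define z where "z = restrict (\<lambda>i. 0 :: real) E"
  define r where "r = restrict (\<lambda>i. (\<bar>x i\<bar> + x i) / 2) E"
  have mem: "q \<in> orthant_facet E e" "z \<in> orthant_facet E e" "r \<in> orthant_facet E e"
    using assms xe by (auto simp: q_def z_def r_def orthant_facet_def)
  show "x \<in> affine_hull_on E (orthant_facet E e)"
  proof (cases "r = q \<or> r = z \<or> q = z")
    case False
    then have "r \<noteq> q" "r \<noteq> z" "q \<noteq> z" by auto
    define c where "c = (\<lambda>v. if v = r then 1 else if v = q then - 1 else (1 :: real))"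
    have "sum c {r, q, z} = 1" using False by (auto simp: c_def)
    moreover have "x i = (\<Sum>v \<in> {r, q, z}. c v * v i)" if "i \<in> E" for i
      using \<open>r \<noteq> q\<close> \<open>r \<noteq> z\<close> \<open>q \<noteq> z\<close> that
      by (simp add: c_def q_def r_def z_def field_simps)
    ultimately show ?thesis
      unfolding affine_hull_on_def using x mem
      by (intro CollectI conjI exI[of _ "{r, q, z}"] exI[of _ c]) auto
  next
    case True
    have rq: "x i = r i - q i" if "i \<in> E" for i
      using that by (simp add: q_def r_def field_simps)
    have *: ?thesis if "r = q"
      unfolding affine_hull_on_def using x mem rq that
      by (intro CollectI conjI exI[of _ "{z}"] exI[of _ "\<lambda>_. 1"]) (auto simp: z_def)
    have **: ?thesis if "q = z"
      unfolding affine_hull_on_def using x mem rq that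
      by (intro CollectI conjI exI[of _ "{r}"] exI[of _ "\<lambda>_. 1"]) (auto simp: z_def)
    have ***: ?thesis if "r = z" "q \<noteq> z"
      unfolding affine_hull_on_def using x mem rq that
      by (intro CollectI conjI exI[of _ "{q, z}"] exI[of _ "\<lambda>v. if v = q then - 1 else 2"])
         (auto simp: z_def)
    show ?thesis using True * ** *** by blast
  qed
qed

lemma relint_orthant_facet:
  assumes "finite E" "e \<in> E"
  shows "relint_on E (orthant_facet E e) =
           {x \<in> E \<rightarrow>\<^sub>E UNIV. x e = 0 \<and> (\<forall>i \<in> E - {e}. 0 < x i)}"
proof (intro equalityI subsetI)
  fix x assume "x \<in> relint_on E (orthant_facet E e)"
  then obtain U where U: "openin (subtopology (powertop_real E)
      (affine_hull_on E (orthant_facet E e))) U" "x \<in> U" "U \<subseteq> orthant_facet E e"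
    by (auto simp: relint_on_def interior_of_def)
  then obtain T where T: "openin (powertop_real E) T"
    "U = T \<inter> {x \<in> E \<rightarrow>\<^sub>E UNIV. x e = 0}"
    using affine_hull_orthant_facet[OF assms] by (auto simp: openin_subtopology)
  have "0 < x i" if i: "i \<in> E - {e}" for i
  proof (rule ccontr)
    assume "\<not> 0 < x i"
    moreover have xO: "x \<in> orthant_facet E e" using U by blast
    ultimately have xi: "x i = 0" using i by (force simp: orthant_facet_def)
    have "x \<in> T" using T U(2) by blast
    then obtain W where W: "\<forall>j \<in> E. openin euclideanreal (W j)" "x \<in> Pi\<^sub>E E W"
      "Pi\<^sub>E E W \<subseteq> T"
      using T(1) unfolding openin_product_topology_alt by blast
    have "open (W i)" "x i \<in> W i" using W i by (auto simp: PiE_iff)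
    obtain r where r: "r > 0" "\<And>t. dist t (x i) < r \<Longrightarrow> t \<in> W i"
      using \<open>open (W i)\<close> \<open>x i \<in> W i\<close> unfolding open_dist by blast
    define y where "y = x(i := - (r / 2))"
    have "y \<in> Pi\<^sub>E E W"
      using W(2) r i xi by (auto simp: y_def PiE_iff extensional_def dist_real_def)
    moreover have "y e = 0" using xO i by (auto simp: y_def orthant_facet_def)
    moreover from \<open>y \<in> Pi\<^sub>E E W\<close> have "y \<in> T" using W(3) by blast
    ultimately have "y \<in> U" using T by (auto simp: PiE_iff)
    then have "y \<in> orthant_facet E e" using U by blast
    then have "0 \<le> y i" using i by (auto simp: orthant_facet_def)
    then show False using r by (simp add: y_def)
  qed
  then show "x \<in> {x \<in> E \<rightarrow>\<^sub>E UNIV. x e = 0 \<and> (\<forall>i \<in> E - {e}. 0 < x i)}"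
    using U by (auto simp: orthant_facet_def)
next
  fix x assume x: "x \<in> {x \<in> E \<rightarrow>\<^sub>E UNIV. x e = 0 \<and> (\<forall>i \<in> E - {e}. (0 :: real) < x i)}"
  define W where "W = (\<lambda>i. if i = e then UNIV else {0 :: real <..})"
  have "openin (powertop_real E) (Pi\<^sub>E E W)"
    using assms by (auto simp: openin_PiE_gen W_def)
  then have "openin (subtopology (powertop_real E) (affine_hull_on E (orthant_facet E e)))
      (Pi\<^sub>E E W \<inter> {x \<in> E \<rightarrow>\<^sub>E UNIV. x e = 0})"
    unfolding affine_hull_orthant_facet[OF assms] by (auto simp: openin_subtopology)
  moreover have "x \<in> Pi\<^sub>E E W \<inter> {x \<in> E \<rightarrow>\<^sub>E UNIV. x e = 0}"
    using x by (auto simp: W_def PiE_iff)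
  moreover have "Pi\<^sub>E E W \<inter> {x \<in> E \<rightarrow>\<^sub>E UNIV. x e = 0} \<subseteq> orthant_facet E e"
    by (force simp: W_def PiE_iff orthant_facet_def split: if_splits)
  ultimately show "x \<in> relint_on E (orthant_facet E e)"
    by (auto simp: relint_on_def interior_of_def)
qed


section \<open>The operators act, and annihilators are ideals\<close>

lemma poly_mapping_sum_single:
  fixes p :: "'b \<Rightarrow>\<^sub>0 'c::comm_monoid_add"
  assumes "finite F" "Poly_Mapping.keys p \<subseteq> F"
  shows "(\<Sum>m \<in> F. Poly_Mapping.single m (Poly_Mapping.lookup p m)) = p"
proof (rule poly_mapping_eqI)
  fix k
  have "Poly_Mapping.lookup (\<Sum>m \<in> F. Poly_Mapping.single m (Poly_Mapping.lookup p m)) k =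
      (\<Sum>m \<in> F. if m = k then Poly_Mapping.lookup p m else 0)"
    by (simp add: lookup_sum lookup_single when_def)
  also have "\<dots> = Poly_Mapping.lookup p k"
    using assms by (auto simp: in_keys_iff)
  finally show "Poly_Mapping.lookup
    (\<Sum>m \<in> F. Poly_Mapping.single m (Poly_Mapping.lookup p m)) k = Poly_Mapping.lookup p k" .
qed

lemma lookup_Const_times [simp]:
  "Poly_Mapping.lookup (Const c * p) n = c * Poly_Mapping.lookup p n"
proof -
  have "Const c * p = (\<Sum>m \<in> Poly_Mapping.keys p.
      Poly_Mapping.single m (c * Poly_Mapping.lookup p m))"
    by (subst (1) poly_mapping_sum_single[OF finite_keys subset_refl, of p, symmetric])
       (simp add: Const_def sum_distrib_left mult_single)
  then have "Poly_Mapping.lookup (Const c * p) n =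
      (\<Sum>m \<in> Poly_Mapping.keys p. if m = n then c * Poly_Mapping.lookup p m else 0)"
    by (simp add: lookup_sum lookup_single when_def)
  also have "\<dots> = c * Poly_Mapping.lookup p n"
    by (auto simp: in_keys_iff)
  finally show ?thesis .
qed

lemma lookup_pdiff:
  "Poly_Mapping.lookup (pdiff e p) n =
     (real (Poly_Mapping.lookup n e) + 1) * Poly_Mapping.lookup p (n + Poly_Mapping.single e 1)"
proof -
  let ?s = "Poly_Mapping.single e (1::nat)"
  have key: "m - ?s = n \<longleftrightarrow> m = n + ?s" if "Poly_Mapping.lookup m e \<noteq> 0" for m
  proof
    assume "m - ?s = n"
    then show "m = n + ?s"
      using that by (intro poly_mapping_eqI) (auto simp: lookup_add lookup_minus lookup_single when_def)
  qed simp
  have "Poly_Mapping.lookup (pdiff e p) n = (\<Sum>m \<in> Poly_Mapping.keys p.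
      if m - ?s = n then real (Poly_Mapping.lookup m e) * Poly_Mapping.lookup p m else 0)"
    by (simp add: pdiff_def lookup_sum lookup_single when_def)
  also have "\<dots> = (\<Sum>m \<in> Poly_Mapping.keys p.
      if m = n + ?s then real (Poly_Mapping.lookup m e) * Poly_Mapping.lookup p m else 0)"
    by (rule sum.cong[OF refl]) (metis key mult_zero_left of_nat_0)
  also have "\<dots> = real (Poly_Mapping.lookup (n + ?s) e) * Poly_Mapping.lookup p (n + ?s)"
    by (simp add: in_keys_iff)
  finally show ?thesis by (simp add: lookup_add)
qed

lemma pdiff_comp_fun_commute:
  "comp_fun_commute (\<lambda>e. pdiff e ^^ Poly_Mapping.lookup m e)"
proof -
  have "comp_fun_commute (pdiff :: 'a \<Rightarrow> _)"
    by standard (auto simp: fun_eq_iff lookup_pdiff lookup_add lookup_single when_def ac_simps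
        intro!: poly_mapping_eqI)
  then show ?thesis by (rule comp_fun_commute.comp_fun_commute_funpow)
qed

lemma lookup_pdiff_power:
  "Poly_Mapping.lookup ((pdiff e ^^ k) p) n =
     pochhammer (real (Poly_Mapping.lookup n e) + 1) k *
     Poly_Mapping.lookup p (n + Poly_Mapping.single e k)"
proof (induction k arbitrary: n)
  case (Suc k)
  have s: "Poly_Mapping.single e (Suc 0) + Poly_Mapping.single e k = Poly_Mapping.single e (Suc k)"
    by (simp flip: single_add)
  show ?case
    by (simp add: lookup_pdiff Suc lookup_add pochhammer_rec s add.assoc)
       (simp add: algebra_simps)
qed simp

lemma lookup_pdiff_monom:
  assumes "finite F" "Poly_Mapping.keys m \<subseteq> F"
  shows "Poly_Mapping.lookup (pdiff_monom m p) n =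
    (\<Prod>e \<in> F. pochhammer (real (Poly_Mapping.lookup n e) + 1) (Poly_Mapping.lookup m e)) *
    Poly_Mapping.lookup p (n + m)"
proof -
  interpret comp_fun_commute "\<lambda>e. pdiff e ^^ Poly_Mapping.lookup m e"
    by (rule pdiff_comp_fun_commute)
  have *: "Poly_Mapping.lookup
      (Finite_Set.fold (\<lambda>e. pdiff e ^^ Poly_Mapping.lookup m e) p G) n =
    (\<Prod>e \<in> G. pochhammer (real (Poly_Mapping.lookup n e) + 1) (Poly_Mapping.lookup m e)) *
    Poly_Mapping.lookup p (n + (\<Sum>e \<in> G. Poly_Mapping.single e (Poly_Mapping.lookup m e)))"
    if "finite G" for G n
    using that
  proof (induction G arbitrary: n)
    case (insert x G)
    have "(\<Prod>e \<in> G. pochhammer (real (Poly_Mapping.lookup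
          (n + Poly_Mapping.single x (Poly_Mapping.lookup m x)) e) + 1) (Poly_Mapping.lookup m e)) =
        (\<Prod>e \<in> G. pochhammer (real (Poly_Mapping.lookup n e) + 1) (Poly_Mapping.lookup m e))"
      by (rule prod.cong) (use insert in \<open>auto simp: lookup_add lookup_single when_def\<close>)
    then show ?case
      using insert by (simp add: lookup_pdiff_power add.assoc)
  qed simp
  have "(\<Prod>e \<in> F. pochhammer (real (Poly_Mapping.lookup n e) + 1) (Poly_Mapping.lookup m e)) =
      (\<Prod>e \<in> Poly_Mapping.keys m.
        pochhammer (real (Poly_Mapping.lookup n e) + 1) (Poly_Mapping.lookup m e))"
    by (rule prod.mono_neutral_right) (use assms in \<open>auto simp: in_keys_iff\<close>)
  then show ?thesis
    by (simp add: pdiff_monom_def * poly_mapping_sum_single)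
qed

lemma pdiff_monom_add: "pdiff_monom (m + n) p = pdiff_monom m (pdiff_monom n p)"
proof (rule poly_mapping_eqI)
  fix k
  define F where "F = Poly_Mapping.keys m \<union> Poly_Mapping.keys n \<union> Poly_Mapping.keys (m + n)"
  have F: "finite F" "Poly_Mapping.keys m \<subseteq> F" "Poly_Mapping.keys n \<subseteq> F"
    "Poly_Mapping.keys (m + n) \<subseteq> F"
    by (auto simp: F_def)
  show "Poly_Mapping.lookup (pdiff_monom (m + n) p) k =
      Poly_Mapping.lookup (pdiff_monom m (pdiff_monom n p)) k"
    by (simp add: lookup_pdiff_monom[OF F(1,2)] lookup_pdiff_monom[OF F(1,3)]
        lookup_pdiff_monom[OF F(1,4)] lookup_add pochhammer_product' prod.distrib ac_simps)
qed

lemma pdiff_monom_sum: "pdiff_monom m (\<Sum>i \<in> I. g i) = (\<Sum>i \<in> I. pdiff_monom m (g i))"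
  by (rule poly_mapping_eqI)
     (simp add: lookup_pdiff_monom[OF finite_keys subset_refl] lookup_sum sum_distrib_left)

lemma pdiff_monom_zero [simp]: "pdiff_monom m 0 = 0"
  by (rule poly_mapping_eqI) (simp add: lookup_pdiff_monom[OF finite_keys subset_refl])

lemma pdiff_monom_Const: "pdiff_monom m (Const c * p) = Const c * pdiff_monom m p"
  by (rule poly_mapping_eqI)
     (simp add: lookup_pdiff_monom[OF finite_keys subset_refl])

lemma Const_add: "Const (a + b) = Const a + Const b"
  by (simp add: Const_def single_add)

lemma Const_mult: "Const (a * b) = Const a * Const b"
  by (simp add: Const_def mult_single)

lemma diff_act_superset:
  assumes "finite F" "Poly_Mapping.keys \<xi> \<subseteq> F"
  shows "diff_act \<xi> p = (\<Sum>m \<in> F. Const (Poly_Mapping.lookup \<xi> m) * pdiff_monom m p)"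
  unfolding diff_act_def
  by (rule sum.mono_neutral_left) (use assms in \<open>auto simp: in_keys_iff Const_def\<close>)

lemma diff_act_add: "diff_act (\<xi> + \<eta>) p = diff_act \<xi> p + diff_act \<eta> p"
proof -
  define F where "F = Poly_Mapping.keys \<xi> \<union> Poly_Mapping.keys \<eta> \<union> Poly_Mapping.keys (\<xi> + \<eta>)"
  have F: "finite F" "Poly_Mapping.keys \<xi> \<subseteq> F" "Poly_Mapping.keys \<eta> \<subseteq> F"
    "Poly_Mapping.keys (\<xi> + \<eta>) \<subseteq> F"
    by (auto simp: F_def)
  show ?thesis
    by (simp add: diff_act_superset[OF F(1,2)] diff_act_superset[OF F(1,3)]
        diff_act_superset[OF F(1,4)] lookup_add Const_add distrib_right sum.distrib)
qed

lemma diff_act_zero [simp]: "diff_act 0 p = 0" "diff_act \<xi> 0 = 0"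
  by (simp_all add: diff_act_def)

lemma diff_act_uminus: "diff_act (- \<xi>) p = - diff_act \<xi> p"
  using diff_act_add[of \<xi> "- \<xi>" p] by (simp add: eq_neg_iff_add_eq_0 add.commute)

lemma diff_act_sum: "diff_act (\<Sum>i \<in> I. g i) p = (\<Sum>i \<in> I. diff_act (g i) p)"
  by (induction I rule: infinite_finite_induct) (auto simp: diff_act_add)

lemma diff_act_single: "diff_act (Poly_Mapping.single m c) p = Const c * pdiff_monom m p"
  by (simp add: diff_act_superset[of "{m}"])

lemma diff_act_Var: "diff_act (Var e) p = pdiff e p"
  by (rule poly_mapping_eqI)
     (simp add: Var_def diff_act_single lookup_pdiff_monom[of "{e}"] lookup_pdiff)

lemma diff_act_mult: "diff_act (\<xi> * \<eta>) p = diff_act \<xi> (diff_act \<eta> p)"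
proof -
  have "\<xi> * \<eta> = (\<Sum>m \<in> Poly_Mapping.keys \<xi>. \<Sum>n \<in> Poly_Mapping.keys \<eta>.
      Poly_Mapping.single (m + n) (Poly_Mapping.lookup \<xi> m * Poly_Mapping.lookup \<eta> n))"
    by (subst (1) poly_mapping_sum_single[OF finite_keys subset_refl, of \<xi>, symmetric],
        subst (1) poly_mapping_sum_single[OF finite_keys subset_refl, of \<eta>, symmetric])
       (simp add: sum_product mult_single)
  then show ?thesis
    by (simp add: diff_act_sum diff_act_single pdiff_monom_add Const_mult)
       (simp add: diff_act_def pdiff_monom_sum pdiff_monom_Const sum_distrib_left mult.assoc)
qed

lemma cring_diff_ring: "cring (diff_ring E)"
proof (rule cringI)
  show "abelian_group (diff_ring E)"
  proof (rule abelian_groupI)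
    fix \<xi> assume "\<xi> \<in> carrier (diff_ring E)"
    then show "\<exists>\<eta> \<in> carrier (diff_ring E). \<eta> \<oplus>\<^bsub>diff_ring E\<^esub> \<xi> = \<zero>\<^bsub>diff_ring E\<^esub>"
      by (intro bexI[of _ "- \<xi>"]) (auto simp: diff_ring_def in_keys_iff)
  next
    fix \<xi> \<eta> assume "\<xi> \<in> carrier (diff_ring E)" "\<eta> \<in> carrier (diff_ring E)"
    then show "\<xi> \<oplus>\<^bsub>diff_ring E\<^esub> \<eta> \<in> carrier (diff_ring E)"
      using keys_add[of \<xi> \<eta>] by (simp add: diff_ring_def) blast
  qed (auto simp: diff_ring_def ac_simps)
  show "Group.comm_monoid (diff_ring E)"
  proof (rule comm_monoidI)
    fix \<xi> \<eta> assume "\<xi> \<in> carrier (diff_ring E)" "\<eta> \<in> carrier (diff_ring E)"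
    then have *: "\<forall>m \<in> Poly_Mapping.keys \<xi>. Poly_Mapping.keys m \<subseteq> E"
      "\<forall>n \<in> Poly_Mapping.keys \<eta>. Poly_Mapping.keys n \<subseteq> E"
      by (simp_all add: diff_ring_def)
    have "Poly_Mapping.keys k \<subseteq> E" if "k \<in> Poly_Mapping.keys (\<xi> * \<eta>)" for k
    proof -
      obtain m n where "m \<in> Poly_Mapping.keys \<xi>" "n \<in> Poly_Mapping.keys \<eta>" "k = m + n"
        using \<open>k \<in> Poly_Mapping.keys (\<xi> * \<eta>)\<close> keys_mult[of \<xi> \<eta>] by blast
      then show ?thesis using * keys_add[of m n] by blast
    qed
    then show "\<xi> \<otimes>\<^bsub>diff_ring E\<^esub> \<eta> \<in> carrier (diff_ring E)"
      by (simp add: diff_ring_def)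
  qed (auto simp: diff_ring_def ac_simps)
qed (auto simp: diff_ring_def distrib_right)

lemma ideal_Ann: "ideal (Ann E f) (diff_ring E)"
proof -
  interpret cring "diff_ring E" by (rule cring_diff_ring)
  have inv: "\<ominus>\<^bsub>diff_ring E\<^esub> \<xi> = - \<xi>" if "\<xi> \<in> carrier (diff_ring E)" for \<xi>
  proof -
    have "- \<xi> \<in> carrier (diff_ring E)" using that by (auto simp: diff_ring_def in_keys_iff)
    then show ?thesis
      using that minus_equality[of "- \<xi>" \<xi>] by (simp add: diff_ring_def)
  qed
  show ?thesis
  proof (rule idealI)
    show "subgroup (Ann E f) (add_monoid (diff_ring E))"
    proof (rule add.subgroupI)
      show "Ann E f \<subseteq> carrier (diff_ring E)" by (auto simp: Ann_def)
      have "0 \<in> Ann E f" by (simp add: Ann_def diff_ring_def)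
      then show "Ann E f \<noteq> {}" by blast
    next
      fix \<xi> assume "\<xi> \<in> Ann E f"
      then have "\<xi> \<in> carrier (diff_ring E)" "diff_act \<xi> f = 0" by (auto simp: Ann_def)
      moreover from this have "- \<xi> \<in> carrier (diff_ring E)"
        by (auto simp: diff_ring_def in_keys_iff)
      ultimately have "- \<xi> \<in> Ann E f" by (simp add: Ann_def diff_act_uminus)
      then show "\<ominus>\<^bsub>diff_ring E\<^esub> \<xi> \<in> Ann E f"
        using inv[OF \<open>\<xi> \<in> carrier (diff_ring E)\<close>] by (simp only:)
    next
      fix \<xi> \<eta> assume "\<xi> \<in> Ann E f" "\<eta> \<in> Ann E f"
      then show "\<xi> \<oplus>\<^bsub>diff_ring E\<^esub> \<eta> \<in> Ann E f"
        using add.m_closed[of \<xi> \<eta>] by (auto simp: Ann_def diff_ring_def diff_act_add)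
    qed
  next
    fix \<xi> \<eta> assume *: "\<xi> \<in> Ann E f" "\<eta> \<in> carrier (diff_ring E)"
    have "diff_act (\<eta> * \<xi>) f = 0" "diff_act (\<xi> * \<eta>) f = 0"
      using * by (simp_all add: Ann_def diff_act_mult mult.commute[of \<xi> \<eta>])
    then show "\<eta> \<otimes>\<^bsub>diff_ring E\<^esub> \<xi> \<in> Ann E f" "\<xi> \<otimes>\<^bsub>diff_ring E\<^esub> \<eta> \<in> Ann E f"
      using * m_closed[of \<xi> \<eta>] m_closed[of \<eta> \<xi>] by (auto simp: Ann_def diff_ring_def)
  qed (rule ring_axioms)
qed

lemma alg_deg_class:
  assumes "\<xi> \<in> carrier (diff_ring E)"
  shows "alg_deg f (alg_class E f \<xi>) = Poly_Mapping.lookup (diff_act \<xi> f) 0"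
proof -
  have "(\<lambda>\<xi>. diff_act \<xi> f) ` alg_class E f \<xi> = {diff_act \<xi> f}"
    using ideal.axioms(1)[OF ideal_Ann[of E f], THEN additive_subgroup.zero_closed]
    by (auto simp: alg_class_def a_r_coset_def r_coset_def Ann_def diff_ring_def diff_act_add)
  then show ?thesis by (simp add: alg_deg_def)
qed

end

theory Submission
  imports Defs
begin

text \<open>
  Write \<open>f\<close> for the basis generating polynomial, \<open>d\<close> for the rank, \<open>l\<close> for the operator \<open>l\<^sub>a\<close>, and
  \<open>w (\<xi>, \<eta>)\<close> for \<open>\<xi> \<eta> l\<^bsup>d-2\<^esup> f\<close>. If \<open>e\<close> is a coloop and \<open>a\<^sub>e = 0\<close>, then \<open>\<partial>\<^sub>i\<close> with \<open>i \<noteq> e\<close> in some basis is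
  primitive, nonzero and isotropic, so the relation fails.

  For the converse, \<open>\<partial>\<^sub>i f\<close> is the polynomial of the contraction by \<open>i\<close>, which allows induction on
  \<open>d\<close>. For positive \<open>a\<close> the form \<open>w\<close> is Lorentzian: for \<open>d = 2\<close> because being parallel is an equivalence
  relation, and for \<open>d \<ge> 3\<close> by a trickling-down argument: the inequalities for all
  \<open>\<partial>\<^sub>i f\<close> say that a self-adjoint Markov operator \<open>T\<close> satisfies \<open>T \<le> T\<^sup>2\<close>, while connectedness
  makes its top eigenvalue \<open>1\<close> simple, so that all others are nonpositive. By continuity \<open>w\<close> is
  negative semidefinite on \<open>l\<^sup>\<bottom>\<close> also if \<open>a\<^sub>e = 0\<close> and \<open>e\<close> is not a coloop. A primitive \<open>\<xi>\<close> with \<open>w (\<xi>, \<xi>) = 0\<close> then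
  lies in the kernel of \<open>w\<close>, hence is primitive and isotropic for every \<open>\<partial>\<^sub>i f\<close> with \<open>i \<noteq> e\<close>; by
  induction \<open>\<partial>\<^sub>i \<xi> f = 0\<close> for all \<open>i \<noteq> e\<close>, and \<open>\<xi> f = 0\<close> since \<open>\<xi> f\<close> is multiaffine.
\<close>

section \<open>A spectral estimate for connected symmetric kernels\<close>

text \<open>First variation: for small \<open>t\<close> with the sign of \<open>b\<close>, the
  linear term would exceed the quadratic one. It yields stationarity of a maximiser and, later, that
  certain isotropic vectors lie in the kernel of a form.\<close>

lemma linear_le_quadratic_imp_zero:
  fixes b c :: real
  assumes "\<And>t. t * b \<le> t\<^sup>2 * c"
  shows "b = 0"
proof (rule ccontr)
  assume "b \<noteq> 0"
  define s where "s = \<bar>c\<bar> + 1"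
  have s: "s > 0" "c < s" by (auto simp: s_def)
  have "b\<^sup>2 / s \<le> b\<^sup>2 * c / s\<^sup>2"
    using assms[of "b / s"] by (simp add: power2_eq_square)
  then have "b\<^sup>2 * s \<le> b\<^sup>2 * c"
    using s by (simp add: field_simps power2_eq_square)
  then show False using s \<open>b \<noteq> 0\<close> by simp
qed

text \<open>Tychonoff's theorem. A bound \<open>c i = 0\<close> pins a coordinate, so functions
  vanishing off a finite set are handled without changing the type.\<close>

lemma compact_box:
  fixes c :: "'a \<Rightarrow> real"
  shows "compact {z :: 'a \<Rightarrow> real. \<forall>i. \<bar>z i\<bar> \<le> c i}"
proof -
  have "compactin (powertop_real UNIV) (\<Pi>\<^sub>E i\<in>UNIV. {- c i..c i})"
    by (subst compactin_PiE) auto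
  moreover have "(\<Pi>\<^sub>E i\<in>UNIV. {- c i..c i}) = {z. \<forall>i. \<bar>z i\<bar> \<le> c i}"
    by (force simp: PiE_iff abs_le_iff minus_le_iff)
  ultimately show ?thesis
    by (simp add: euclidean_product_topology)
qed

text \<open>
  With \<open>T z = (K z) / m\<close>, self-adjoint for the weights \<open>m\<close>, the assumption \<open>hyp\<close> is \<open>T \<le> T\<^sup>2\<close>. A
  maximiser of the Rayleigh quotient on the orthogonal complement of the constants is an
  eigenvector; a positive eigenvalue would be at least \<open>1\<close>, and the Dirichlet form would force the
  eigenvector to be constant.
\<close>

lemma symmetric_kernel_nonpos:
  fixes K :: "'a \<Rightarrow> 'a \<Rightarrow> real"
  assumes fin: "finite V"
    and sym: "\<And>i j. K i j = K j i"
    and nonneg: "\<And>i j. 0 \<le> K i j"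
    and m: "\<And>i. i \<in> V \<Longrightarrow> m i = (\<Sum>j\<in>V. K i j)"
    and mpos: "\<And>i. i \<in> V \<Longrightarrow> 0 < m i"
    and conn: "\<And>z :: 'a \<Rightarrow> real. (\<And>i j. i \<in> V \<Longrightarrow> j \<in> V \<Longrightarrow> 0 < K i j \<Longrightarrow> z i = z j)
      \<Longrightarrow> \<exists>c. \<forall>i\<in>V. z i = c"
    and hyp: "\<And>z. (\<Sum>i\<in>V. \<Sum>j\<in>V. K i j * z i * z j) \<le> (\<Sum>i\<in>V. (\<Sum>j\<in>V. K i j * z j)\<^sup>2 / m i)"
    and x: "(\<Sum>i\<in>V. m i * x i) = 0"
  shows "(\<Sum>i\<in>V. \<Sum>j\<in>V. K i j * x i * x j) \<le> 0"
proof (rule ccontr)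
  define q where "q y z = (\<Sum>i\<in>V. \<Sum>j\<in>V. K i j * y i * z j)" for y z
  define N where "N y z = (\<Sum>i\<in>V. m i * y i * z i)" for y z
  assume "\<not> ?thesis"
  then have qx: "q x x > 0" by (simp add: q_def)
  have q_sym: "q y z = q z y" for y z
    unfolding q_def by (subst sum.swap) (simp add: sym mult.assoc mult.commute mult.left_commute)
  have N_sym: "N y z = N z y" for y z
    by (simp add: N_def mult.commute mult.left_commute)
  have q_lin: "q y (\<lambda>i. s * z i + t * w i) = s * q y z + t * q y w" for y z w s t
    by (simp add: q_def sum_distrib_left sum.distrib algebra_simps)
  have N_lin: "N y (\<lambda>i. s * z i + t * w i) = s * N y z + t * N y w" for y z w s t
    by (simp add: N_def sum_distrib_left sum.distrib algebra_simps)
  have q_sc: "q (\<lambda>i. s * y i) (\<lambda>i. s * y i) = s\<^sup>2 * q y y" for y s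
    by (simp add: q_def sum_distrib_left power2_eq_square algebra_simps)
  have N_sc: "N (\<lambda>i. s * y i) (\<lambda>i. s * y i) = s\<^sup>2 * N y y" for y s
    by (simp add: N_def sum_distrib_left power2_eq_square algebra_simps)
  \<comment> \<open>The row sums of \<open>K\<close> are \<open>m\<close>, so the constant function
    is an eigenvector of \<open>T\<close> with eigenvalue \<open>1\<close>.\<close>
  have q_one: "q y (\<lambda>_. 1) = N y (\<lambda>_. 1)" for y
    by (simp add: q_def N_def m mult.commute flip: sum_distrib_left)
  have N_nonneg: "N y y \<ge> 0" for y
    unfolding N_def by (intro sum_nonneg) (simp add: mpos less_imp_le mult.assoc)
  have N_term: "m i * (z i)\<^sup>2 \<le> N z z" if "i \<in> V" for i z
    unfolding N_def using that fin mpos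
    by (intro order_trans[OF _ member_le_sum[of i V "\<lambda>i. m i * z i * z i"]])
       (auto simp: power2_eq_square mult.assoc less_imp_le)
  have N_pos: "N y y > 0" if "q y y > 0" for y
  proof -
    have "\<exists>i\<in>V. y i \<noteq> 0"
      using that by (intro ccontr[of "\<exists>i\<in>V. y i \<noteq> 0"]) (simp add: q_def)
    then obtain i where "i \<in> V" "y i \<noteq> 0" by blast
    then have "0 < m i * (y i)\<^sup>2" using mpos by simp
    then show ?thesis using N_term[OF \<open>i \<in> V\<close>, of y] by simp
  qed
  \<comment> \<open>The unit sphere of \<open>N\<close> in the complement of the constants. Values
    off \<open>V\<close> are set to zero, since \<open>N\<close> does not control them and
    \<open>Z\<close> must be compact.\<close>
  define Z where "Z = {z. (\<forall>i. i \<notin> V \<longrightarrow> z i = 0) \<and> N z (\<lambda>_. 1) = 0 \<and> N z z = 1}"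
  \<comment> \<open>The bound comes from \<open>2 * \<bar>z i\<bar> \<le> 1 + (z i)\<^sup>2\<close>
    and \<open>(z i)\<^sup>2 \<le> 1 / m i\<close>, which avoids square roots.\<close>
  define box where "box = {z :: 'a \<Rightarrow> real. \<forall>i. \<bar>z i\<bar> \<le> (if i \<in> V then 1 + 1 / m i else 0)}"
  have coord: "continuous_on A (\<lambda>z :: 'a \<Rightarrow> real. z i)" for A i
    by (rule continuous_on_product_coordinates[THEN continuous_on_subset]) simp
  have "Z \<subseteq> box"
  proof
    fix z assume z: "z \<in> Z"
    have "\<bar>z i\<bar> \<le> 1 + 1 / m i" if i: "i \<in> V" for i
    proof -
      have "(z i)\<^sup>2 \<le> 1 / m i"
        using N_term[OF i, of z] z mpos[OF i] by (simp add: Z_def field_simps)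
      moreover have "2 * \<bar>z i\<bar> \<le> 1 + (z i)\<^sup>2"
        using zero_le_power2[of "\<bar>z i\<bar> - 1"] by (simp add: power2_eq_square algebra_simps)
      ultimately show ?thesis using mpos[OF i] by (simp add: add_increasing)
    qed
    then show "z \<in> box" using z by (auto simp: box_def Z_def)
  qed
  have closed: "closed {z. N z (\<lambda>_. 1) = 0 \<and> N z z = 1}"
    unfolding N_def by (intro closed_Collect_conj closed_Collect_eq continuous_intros coord)
  have Z_eq: "Z = box \<inter> {z. N z (\<lambda>_. 1) = 0 \<and> N z z = 1}"
  proof
    show "Z \<subseteq> box \<inter> {z. N z (\<lambda>_. 1) = 0 \<and> N z z = 1}"
      using \<open>Z \<subseteq> box\<close> by (auto simp: Z_def)
    show "box \<inter> {z. N z (\<lambda>_. 1) = 0 \<and> N z z = 1} \<subseteq> Z"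
      by (auto simp: Z_def box_def)
  qed
  have "compact Z"
    unfolding Z_eq by (rule compact_Int_closed[OF _ closed]) (unfold box_def, rule compact_box)
  moreover have normalise: "(\<lambda>i. if i \<in> V then y i / sqrt (N y y) else 0) \<in> Z \<and>
      q (\<lambda>i. if i \<in> V then y i / sqrt (N y y) else 0) (\<lambda>i. if i \<in> V then y i / sqrt (N y y) else 0)
        = q y y / N y y"
    if "N y (\<lambda>_. 1) = 0" "N y y > 0" for y
  proof -
    have "N (\<lambda>i. if i \<in> V then y i / sqrt (N y y) else 0) (\<lambda>_. 1) = N y (\<lambda>_. 1) / sqrt (N y y)"
      unfolding N_def by (subst sum_divide_distrib) (auto intro: sum.cong)
    moreover have "N (\<lambda>i. if i \<in> V then y i / sqrt (N y y) else 0)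
        (\<lambda>i. if i \<in> V then y i / sqrt (N y y) else 0) = N (\<lambda>i. (1 / sqrt (N y y)) * y i) (\<lambda>i. (1 / sqrt (N y y)) * y i)"
      by (subst (1 4) N_def) (auto intro!: sum.cong)
    moreover have "q (\<lambda>i. if i \<in> V then y i / sqrt (N y y) else 0)
        (\<lambda>i. if i \<in> V then y i / sqrt (N y y) else 0) = q (\<lambda>i. (1 / sqrt (N y y)) * y i) (\<lambda>i. (1 / sqrt (N y y)) * y i)"
      by (subst (1 2) q_def) (auto intro!: sum.cong)
    ultimately show ?thesis using that unfolding Z_def q_sc N_sc
      by (simp add: power_divide)
  qed
  moreover have Nx: "N x (\<lambda>_. 1) = 0" using x by (simp add: N_def)
  moreover have "continuous_on Z (\<lambda>z. q z z)"
    unfolding q_def by (intro continuous_intros coord)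
  ultimately obtain u where u: "u \<in> Z" and umax: "\<And>z. z \<in> Z \<Longrightarrow> q z z \<le> q u u"
    using continuous_attains_sup[of Z "\<lambda>z. q z z"] N_pos[OF qx] by blast
  define l where "l = q u u"
  have "l > 0"
    using umax[OF conjunct1[OF normalise[OF Nx N_pos[OF qx]]]]
      conjunct2[OF normalise[OF Nx N_pos[OF qx]]] divide_pos_pos[OF qx N_pos[OF qx]]
    by (simp only: l_def)
  have bound: "q y y \<le> l * N y y" if "N y (\<lambda>_. 1) = 0" for y
  proof (cases "q y y > 0")
    case True
    then have "q y y / N y y \<le> l"
      using umax[OF conjunct1[OF normalise[OF that N_pos]]]
        conjunct2[OF normalise[OF that N_pos]]
      by (simp only: l_def)
    then show ?thesis using N_pos[OF True] by (simp add: field_simps)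
  next
    case False
    then show ?thesis using N_nonneg[of y] \<open>l > 0\<close>
      by (auto intro: order_trans[of "q y y" 0 "l * N y y"])
  qed
  have uZ: "N u (\<lambda>_. 1) = 0" "N u u = 1" using u by (auto simp: Z_def)
  \<comment> \<open>Along \<open>u + t z\<close> the function \<open>l * N - q\<close> is
    nonnegative and vanishes at \<open>t = 0\<close>, so its linear coefficient is zero.\<close>
  have stat0: "q u z = l * N u z" if z: "N z (\<lambda>_. 1) = 0" for z
  proof -
    have "2 * (q u z - l * N u z) = 0"
    proof (rule linear_le_quadratic_imp_zero)
      fix t
      let ?y = "\<lambda>i. 1 * u i + t * z i"
      have "N (\<lambda>_. 1) ?y = 0"
        unfolding N_lin using uZ z by (simp add: N_sym)
      then have "q ?y ?y \<le> l * N ?y ?y"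
        by (intro bound) (subst N_sym)
      moreover have "q ?y ?y = 1 * q u ?y + t * q z ?y" "N ?y ?y = 1 * N u ?y + t * N z ?y"
        using q_lin[of ?y 1 u t z] N_lin[of ?y 1 u t z]
        by (simp_all only: q_sym[of ?y u] q_sym[of ?y z] N_sym[of ?y u] N_sym[of ?y z])
      moreover have "1 * q u ?y + t * q z ?y = l + 2 * t * q u z + t\<^sup>2 * q z z"
        unfolding q_lin by (simp add: q_sym[of z u] l_def algebra_simps power2_eq_square)
      moreover have "1 * N u ?y + t * N z ?y = 1 + 2 * t * N u z + t\<^sup>2 * N z z"
        unfolding N_lin by (simp add: N_sym[of z u] uZ algebra_simps power2_eq_square)
      ultimately have "l + 2 * t * q u z + t\<^sup>2 * q z z \<le> l * (1 + 2 * t * N u z + t\<^sup>2 * N z z)"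
        by simp
      then show "t * (2 * (q u z - l * N u z)) \<le> t\<^sup>2 * (l * N z z - q z z)"
        by (simp add: algebra_simps)
    qed
    then show ?thesis by simp
  qed
  have stat: "q u z = l * N u z" for z
  proof (cases "V = {}")
    case True then show ?thesis by (simp add: q_def N_def)
  next
    case False
    define M where "M = N (\<lambda>_. 1) (\<lambda>_. 1)"
    have "M > 0" unfolding M_def N_def using False fin mpos by (auto intro!: sum_pos)
    \<comment> \<open>Subtracting the weighted mean moves \<open>z\<close> into the complement of
      the constants, where \<open>stat0\<close> applies. By \<open>q_one\<close> and
      \<open>uZ\<close> neither side sees the constant part.\<close>
    let ?y = "\<lambda>i. 1 * z i + (- N z (\<lambda>_. 1) / M) * 1"
    have "N (\<lambda>_. 1) ?y = 0" unfolding N_lin using \<open>M > 0\<close> by (simp add: M_def N_sym)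
    then have "q u ?y = l * N u ?y" using stat0[of ?y] by (simp only: N_sym)
    then show ?thesis unfolding q_lin N_lin by (simp add: q_one uZ)
  qed
  have eigen: "(\<Sum>j\<in>V. K i j * u j) = l * m i * u i" if i: "i \<in> V" for i
  proof -
    let ?d = "\<lambda>j. if j = i then 1 else 0 :: real"
    have "q ?d u = (\<Sum>k\<in>V. if k = i then \<Sum>j\<in>V. K i j * u j else 0)"
      unfolding q_def by (intro sum.cong) auto
    moreover have "N u ?d = (\<Sum>k\<in>V. if k = i then m i * u i else 0)"
      unfolding N_def by (intro sum.cong) auto
    ultimately show ?thesis
      using stat[of ?d] i fin by (simp add: q_sym[of u])
  qed
  \<comment> \<open>At the eigenvector \<open>u\<close> the assumption \<open>hyp\<close> becomes
    \<open>l \<le> l\<^sup>2\<close>.\<close>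
  have "l \<le> (\<Sum>i\<in>V. (l * m i * u i)\<^sup>2 / m i)"
    using hyp[of u] by (simp add: eigen l_def[unfolded q_def])
  also have "\<dots> = l\<^sup>2 * N u u"
    unfolding N_def sum_distrib_left
    by (intro sum.cong refl) (use mpos in \<open>force simp: power2_eq_square\<close>)
  finally have "l \<ge> 1" using \<open>l > 0\<close> uZ by (simp add: power2_eq_square)
  \<comment> \<open>The Dirichlet form of \<open>u\<close> equals \<open>2 - 2 * l\<close>, which is
    at most zero, while each of its terms is nonnegative.\<close>
  have "(\<Sum>i\<in>V. \<Sum>j\<in>V. K i j * (u i - u j)\<^sup>2) =
      (\<Sum>i\<in>V. \<Sum>j\<in>V. K i j * u i * u i) + (\<Sum>i\<in>V. \<Sum>j\<in>V. K i j * u j * u j) - 2 * q u u"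
    by (simp add: q_def sum_distrib_left power2_eq_square algebra_simps sum.distrib sum_subtractf)
  also have "(\<Sum>i\<in>V. \<Sum>j\<in>V. K i j * u i * u i) = N u u"
    by (simp add: N_def m sum_distrib_right)
  also have "(\<Sum>i\<in>V. \<Sum>j\<in>V. K i j * u j * u j) = N u u"
    by (subst sum.swap) (simp add: N_def m sum_distrib_right sym)
  finally have "(\<Sum>i\<in>V. \<Sum>j\<in>V. K i j * (u i - u j)\<^sup>2) \<le> 0"
    using uZ \<open>l \<ge> 1\<close> by (simp add: l_def)
  then have "(\<Sum>i\<in>V. \<Sum>j\<in>V. K i j * (u i - u j)\<^sup>2) = 0"
    by (intro antisym sum_nonneg) (auto intro: mult_nonneg_nonneg nonneg)
  then have zero: "K i j * (u i - u j)\<^sup>2 = 0" if "i \<in> V" "j \<in> V" for i j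
    using that fin nonneg by (simp add: sum_nonneg_eq_0_iff sum_nonneg)
  then have "\<exists>c. \<forall>i\<in>V. u i = c"
    by (intro conn) fastforce
  then obtain c where c: "\<And>i. i \<in> V \<Longrightarrow> u i = c" by blast
  \<comment> \<open>A constant \<open>u\<close> orthogonal to the constants has norm zero, against
    \<open>N u u = 1\<close>.\<close>
  have "N u u = c * N u (\<lambda>_. 1)"
    by (simp add: N_def c sum_distrib_left mult.commute)
  then show False using uZ by simp
qed

section \<open>Set families, contractions and derivatives\<close>

text \<open>The formula of \<open>basis_gen_poly\<close> for an arbitrary family, so that inductions
  can pass to contractions without describing their independent sets.\<close>

definition family_poly :: "'a set set \<Rightarrow> 'a rpoly" where
  "family_poly \<B> = (\<Sum>B\<in>\<B>. \<Prod>e\<in>B. Var e)"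

text \<open>For a loop \<open>i\<close> this is the empty family, unlike the usual matroid
  contraction; this matches the vanishing of the derivative by \<open>i\<close>.\<close>

definition contraction :: "'a \<Rightarrow> 'a set set \<Rightarrow> 'a set set" where
  "contraction i \<B> = (\<lambda>B. B - {i}) ` {B \<in> \<B>. i \<in> B}"

definition indicator_monom :: "'a set \<Rightarrow> 'a \<Rightarrow>\<^sub>0 nat" where
  "indicator_monom B = (\<Sum>e\<in>B. Poly_Mapping.single e 1)"

lemma lookup_indicator_monom:
  "finite B \<Longrightarrow> Poly_Mapping.lookup (indicator_monom B) x = (if x \<in> B then 1 else 0)"
  by (simp add: indicator_monom_def lookup_sum lookup_single when_def)

lemma keys_indicator_monom: "finite B \<Longrightarrow> Poly_Mapping.keys (indicator_monom B) = B"
  by (auto simp: in_keys_iff lookup_indicator_monom split: if_splits)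

lemma prod_Var: "finite B \<Longrightarrow> (\<Prod>e\<in>B. Var e) = Poly_Mapping.single (indicator_monom B) 1"
proof (induction B rule: finite_induct)
  case empty
  then show ?case by (simp add: indicator_monom_def)
next
  case (insert x B)
  then show ?case by (simp add: Var_def mult_single indicator_monom_def)
qed

text \<open>Distinct finite sets have distinct exponent vectors, so no two monomials of the sum
  merge.\<close>

lemma lookup_family_poly:
  assumes "finite \<B>" "\<And>B. B \<in> \<B> \<Longrightarrow> finite B"
  shows "Poly_Mapping.lookup (family_poly \<B>) n = of_bool (n \<in> indicator_monom ` \<B>)"
proof -
  have inj: "inj_on indicator_monom \<B>"
    by (rule inj_onI) (metis assms(2) keys_indicator_monom)
  have "family_poly \<B> = (\<Sum>B\<in>\<B>. Poly_Mapping.single (indicator_monom B) 1)"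
    unfolding family_poly_def by (intro sum.cong refl prod_Var assms)
  also have "\<dots> = (\<Sum>m\<in>indicator_monom ` \<B>. Poly_Mapping.single m 1)"
    by (simp add: sum.reindex[OF inj])
  finally show ?thesis
    using assms(1) by (simp add: lookup_sum lookup_single when_def)
qed

text \<open>All monomials are squarefree: the derivative kills those without \<open>i\<close> and
  strikes \<open>i\<close> from the others.\<close>

lemma pdiff_family_poly:
  assumes "finite \<B>" "\<And>B. B \<in> \<B> \<Longrightarrow> finite B"
  shows "pdiff i (family_poly \<B>) = family_poly (contraction i \<B>)"
proof (rule poly_mapping_eqI)
  fix n
  let ?s = "Poly_Mapping.single i (1::nat)"
  have fin: "finite (contraction i \<B>)" "\<And>B. B \<in> contraction i \<B> \<Longrightarrow> finite B"
    using assms by (auto simp: contraction_def)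
  have *: "indicator_monom B = n + ?s \<longleftrightarrow> i \<in> B \<and> indicator_monom (B - {i}) = n" if "B \<in> \<B>" for B
  proof (cases "i \<in> B")
    case True
    then have "indicator_monom B = indicator_monom (B - {i}) + ?s"
      using assms that by (simp add: indicator_monom_def sum.remove[of B i] add.commute)
    then show ?thesis using True by simp
  next
    case False
    then have "Poly_Mapping.lookup (indicator_monom B) i \<noteq> Poly_Mapping.lookup (n + ?s) i"
      using assms that by (simp add: lookup_indicator_monom lookup_add)
    then show ?thesis using False by auto
  qed
  have mem: "n + ?s \<in> indicator_monom ` \<B> \<longleftrightarrow> n \<in> indicator_monom ` contraction i \<B>"
  proof
    assume "n + ?s \<in> indicator_monom ` \<B>"
    then obtain B where "B \<in> \<B>" "indicator_monom B = n + ?s" by force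
    then show "n \<in> indicator_monom ` contraction i \<B>"
      using * by (auto simp: contraction_def)
  next
    assume "n \<in> indicator_monom ` contraction i \<B>"
    then obtain B where "B \<in> \<B>" "i \<in> B" "indicator_monom (B - {i}) = n"
      by (auto simp: contraction_def)
    then show "n + ?s \<in> indicator_monom ` \<B>"
      using * by (metis imageI)
  qed
  \<comment> \<open>Hence the factor \<open>lookup n i + 1\<close> produced by differentiation is
    \<open>1\<close> wherever the coefficient is nonzero.\<close>
  have "Poly_Mapping.lookup n i = 0" if "n \<in> indicator_monom ` contraction i \<B>"
    using that assms by (auto simp: contraction_def lookup_indicator_monom)
  then show "Poly_Mapping.lookup (pdiff i (family_poly \<B>)) n =
      Poly_Mapping.lookup (family_poly (contraction i \<B>)) n"
    using mem by (auto simp: lookup_pdiff lookup_family_poly[OF assms] lookup_family_poly[OF fin])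
qed

text \<open>The degree map before passing to classes, see \<open>alg_deg_class\<close>. It is
  defined for all operators, so it is linear without any grading.\<close>

definition diff_const :: "'a rpoly \<Rightarrow> 'a rpoly \<Rightarrow> real" where
  "diff_const \<xi> p = Poly_Mapping.lookup (diff_act \<xi> p) 0"

lemma diff_act_Const: "diff_act (Const c) p = Const c * p"
proof -
  have "pdiff_monom 0 p = p"
    by (rule poly_mapping_eqI) (simp add: lookup_pdiff_monom[of "{}"])
  then show ?thesis
    using diff_act_single[of 0 c p, folded Const_def] by simp
qed

lemma diff_act_Const_mult: "diff_act (Const c * \<xi>) p = Const c * diff_act \<xi> p"
  by (simp add: diff_act_mult diff_act_Const)

lemma diff_const_add: "diff_const (\<xi> + \<eta>) p = diff_const \<xi> p + diff_const \<eta> p"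
  by (simp add: diff_const_def diff_act_add lookup_add)

lemma diff_const_Const: "diff_const (Const c * \<xi>) p = c * diff_const \<xi> p"
  by (simp add: diff_const_def diff_act_Const_mult)

lemma diff_const_sum: "diff_const (\<Sum>i\<in>I. g i) p = (\<Sum>i\<in>I. diff_const (g i) p)"
  by (simp add: diff_const_def diff_act_sum lookup_sum)

lemma diff_const_zero [simp]: "diff_const \<xi> 0 = 0"
  by (simp add: diff_const_def)

lemma diff_act_Var_mult: "diff_act (Var i * \<xi>) p = diff_act \<xi> (pdiff i p)"
  by (simp add: mult.commute[of "Var i"] diff_act_mult diff_act_Var)

lemma diff_const_Var: "diff_const (Var i * \<xi>) p = diff_const \<xi> (pdiff i p)"
  by (simp add: diff_const_def diff_act_Var_mult)

section \<open>Expansion of operators along linear forms\<close>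

lemma linear_form_mult: "linear_form E x * \<xi> = (\<Sum>i\<in>E. Const (x i) * (Var i * \<xi>))"
  by (simp add: linear_form_def sum_distrib_right mult.assoc)

lemma diff_const_linear_form:
  "diff_const (linear_form E x * \<xi>) p = (\<Sum>i\<in>E. x i * diff_const (Var i * \<xi>) p)"
  by (simp add: linear_form_mult diff_const_sum diff_const_Const)

lemma diff_act_linear_form:
  "diff_act (linear_form E x * \<xi>) p = (\<Sum>i\<in>E. Const (x i) * diff_act \<xi> (pdiff i p))"
  by (simp add: linear_form_mult diff_act_sum diff_act_Const_mult diff_act_Var_mult)

lemma linear_form_add_scaled:
  "linear_form E (\<lambda>i. x i + t * y i) = linear_form E x + Const t * linear_form E y"
  by (simp add: linear_form_def Const_add Const_mult algebra_simps sum.distrib sum_distrib_left)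

lemma diff_const_square_add_scaled:
  "diff_const (linear_form E (\<lambda>i. x i + t * y i) * linear_form E (\<lambda>i. x i + t * y i) * P) f =
     diff_const (linear_form E x * linear_form E x * P) f
     + 2 * t * diff_const (linear_form E x * linear_form E y * P) f
     + t\<^sup>2 * diff_const (linear_form E y * linear_form E y * P) f"
proof -
  let ?X = "linear_form E x" and ?Y = "linear_form E y"
  have "(?X + Const t * ?Y) * (?X + Const t * ?Y) * P =
      ?X * ?X * P + Const t * (?X * ?Y * P) + Const t * (?X * ?Y * P) + Const t * (Const t * (?Y * ?Y * P))"
    by (simp add: algebra_simps)
  then show ?thesis
    unfolding linear_form_add_scaled
    by (simp only: diff_const_add diff_const_Const) (simp add: power2_eq_square)
qed

lemma diff_const_add_scaled:
  "diff_const (linear_form E (\<lambda>i. x i + t * y i) * P) f =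
     diff_const (linear_form E x * P) f + t * diff_const (linear_form E y * P) f"
  by (simp add: linear_form_add_scaled distrib_right mult.assoc diff_const_add diff_const_Const)

text \<open>The expression is polynomial in \<open>t\<close>. One factor of the power is split into
  its two summands and absorbed into \<open>\<xi>\<close>, which is therefore generalised in the
  induction.\<close>

lemma isCont_diff_const_power:
  "isCont (\<lambda>t. diff_const (\<xi> * linear_form E (\<lambda>i. a i + t * b i) ^ n) f) s"
proof (induction n arbitrary: \<xi>)
  case (Suc n)
  have "\<xi> * linear_form E (\<lambda>i. a i + t * b i) ^ Suc n =
      (\<xi> * linear_form E a) * linear_form E (\<lambda>i. a i + t * b i) ^ n
      + Const t * ((\<xi> * linear_form E b) * linear_form E (\<lambda>i. a i + t * b i) ^ n)" for t
    by (simp add: linear_form_add_scaled algebra_simps)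
  then show ?case
    by (simp add: diff_const_add diff_const_Const Suc.IH del: power_Suc)
qed simp

lemma diff_const_one: "diff_const 1 p = Poly_Mapping.lookup p 0"
  using diff_act_Const[of 1 p] by (simp add: diff_const_def Const_def)

definition exchange_family :: "'a set \<Rightarrow> nat \<Rightarrow> 'a set set \<Rightarrow> bool" where
  "exchange_family E d \<B> \<longleftrightarrow> finite E \<and> (\<forall>B\<in>\<B>. B \<subseteq> E \<and> card B = d) \<and>
     (\<forall>A\<in>\<B>. \<forall>B\<in>\<B>. \<forall>x\<in>A - B. \<exists>y\<in>B - A. insert y (A - {x}) \<in> \<B>)"

lemma exchange_familyD:
  assumes "exchange_family E d \<B>"
  shows "finite E" "finite \<B>" "\<And>B. B \<in> \<B> \<Longrightarrow> B \<subseteq> E" "\<And>B. B \<in> \<B> \<Longrightarrow> card B = d"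
    "\<And>B. B \<in> \<B> \<Longrightarrow> finite B"
proof -
  show E: "finite E" and sub: "\<And>B. B \<in> \<B> \<Longrightarrow> B \<subseteq> E" and "\<And>B. B \<in> \<B> \<Longrightarrow> card B = d"
    using assms by (auto simp: exchange_family_def)
  show "\<And>B. B \<in> \<B> \<Longrightarrow> finite B" using E sub finite_subset by blast
  have "\<B> \<subseteq> Pow E" using sub by blast
  then show "finite \<B>" using E finite_subset by blast
qed

lemma exchange_family_exchange:
  assumes "exchange_family E d \<B>" "A \<in> \<B>" "B \<in> \<B>" "x \<in> A" "x \<notin> B"
  obtains y where "y \<in> B" "y \<notin> A" "insert y (A - {x}) \<in> \<B>"
  using assms unfolding exchange_family_def by blast

text \<open>An exchange between two members containing \<open>i\<close> removes some
  \<open>x \<noteq> i\<close>, so the new member still contains \<open>i\<close>.\<close>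

lemma exchange_family_contraction:
  assumes "exchange_family E (Suc d) \<B>"
  shows "exchange_family E d (contraction i \<B>)"
proof -
  note D = exchange_familyD[OF assms]
  have "\<exists>y\<in>B' - A'. insert y (A' - {x}) \<in> contraction i \<B>"
    if mem: "A' \<in> contraction i \<B>" "B' \<in> contraction i \<B>" and x: "x \<in> A' - B'" for A' B' x
  proof -
    obtain A B where A: "A \<in> \<B>" "i \<in> A" "A' = A - {i}" and B: "B \<in> \<B>" "i \<in> B" "B' = B - {i}"
      using mem by (auto simp: contraction_def)
    obtain y where y: "y \<in> B" "y \<notin> A" "insert y (A - {x}) \<in> \<B>"
      using exchange_family_exchange[OF assms A(1) B(1), of x] x A B by blast
    have "insert y (A' - {x}) = insert y (A - {x}) - {i}" "i \<in> insert y (A - {x})"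
      using A x y by auto
    then have "insert y (A' - {x}) \<in> contraction i \<B>"
      using y unfolding contraction_def by blast
    then show ?thesis using A B y by blast
  qed
  moreover have "B \<subseteq> E \<and> card B = d" if "B \<in> contraction i \<B>" for B
    using that D by (auto simp: contraction_def)
  ultimately show ?thesis using D(1) by (simp add: exchange_family_def)
qed

lemma pdiff_exchange_family:
  "exchange_family E d \<B> \<Longrightarrow> pdiff i (family_poly \<B>) = family_poly (contraction i \<B>)"
  by (intro pdiff_family_poly exchange_familyD)

lemma diff_const_Var_family:
  "exchange_family E d \<B> \<Longrightarrow>
    diff_const (Var i * \<xi>) (family_poly \<B>) = diff_const \<xi> (family_poly (contraction i \<B>))"
  by (simp add: diff_const_Var pdiff_exchange_family)

lemma lookup_zero_family_poly:
  assumes "exchange_family E d \<B>"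
  shows "Poly_Mapping.lookup (family_poly \<B>) 0 = of_bool ({} \<in> \<B>)"
proof -
  have "indicator_monom B = 0 \<longleftrightarrow> B = {}" if "B \<in> \<B>" for B
    using keys_indicator_monom[OF exchange_familyD(5)[OF assms that]]
    by (auto simp: indicator_monom_def)
  then have "0 \<in> indicator_monom ` \<B> \<longleftrightarrow> {} \<in> \<B>"
    by (metis image_iff)
  then show ?thesis
    by (simp add: lookup_family_poly exchange_familyD[OF assms])
qed

lemma diff_const_power_nonneg:
  assumes "exchange_family E d \<B>" "\<And>i. i \<in> E \<Longrightarrow> 0 \<le> a i"
  shows "0 \<le> diff_const (linear_form E a ^ d) (family_poly \<B>)"
  using assms(1)
proof (induction d arbitrary: \<B>)
  case 0
  then show ?case by (simp add: diff_const_one lookup_zero_family_poly)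
next
  case (Suc d)
  then show ?case
    using exchange_family_contraction[OF Suc.prems] assms(2)
    by (simp add: diff_const_linear_form diff_const_Var_family sum_nonneg)
qed

text \<open>Peeling off one linear factor gives a nonnegative combination over contractions, in
  which an element of \<open>B\<close> contributes a positive term. Positivity on a single member
  covers weights vanishing at an element outside it.\<close>

lemma diff_const_power_pos:
  assumes "exchange_family E d \<B>" "\<And>i. i \<in> E \<Longrightarrow> 0 \<le> a i"
    and "B \<in> \<B>" "\<And>i. i \<in> B \<Longrightarrow> 0 < a i"
  shows "0 < diff_const (linear_form E a ^ d) (family_poly \<B>)"
  using assms(1,3,4)
proof (induction d arbitrary: \<B> B)
  case 0
  then have "B = {}" using exchange_familyD(4,5)[OF 0(1) 0(2)] by simp
  then show ?case using 0 by (simp add: diff_const_one lookup_zero_family_poly)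
next
  case (Suc d)
  note D = exchange_familyD[OF Suc.prems(1)]
  obtain i where i: "i \<in> B" using D(4)[OF Suc.prems(2)] by fastforce
  have iE: "i \<in> E" using i D(3)[OF Suc.prems(2)] by blast
  let ?g = "\<lambda>j. a j * diff_const (linear_form E a ^ d) (family_poly (contraction j \<B>))"
  have "0 < ?g i"
    using Suc.prems i
    by (intro mult_pos_pos Suc.IH[of "contraction i \<B>" "B - {i}"] exchange_family_contraction)
       (auto simp: contraction_def)
  moreover have "0 \<le> ?g j" if "j \<in> E" for j
    using that assms(2) diff_const_power_nonneg[OF exchange_family_contraction[OF Suc.prems(1)] assms(2)]
    by simp
  ultimately have "0 < (\<Sum>j\<in>E. ?g j)"
    using iE D(1) by (meson sum_pos2)
  then show ?case
    by (simp add: diff_const_linear_form diff_const_Var_family[OF Suc.prems(1)])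
qed

section \<open>The Lorentzian inequality\<close>

lemma family_poly_empty [simp]: "family_poly {} = 0"
  by (simp add: family_poly_def)

lemma contraction_eq_empty: "i \<notin> \<Union>\<B> \<Longrightarrow> contraction i \<B> = {}"
  by (auto simp: contraction_def)

lemma diff_const_Var_Var:
  assumes "exchange_family E (Suc d) \<B>"
  shows "diff_const (Var i * Var j * \<xi>) (family_poly \<B>) =
    diff_const \<xi> (family_poly (contraction j (contraction i \<B>)))"
  by (simp add: mult.assoc diff_const_Var_family[OF assms]
      diff_const_Var_family[OF exchange_family_contraction[OF assms]])

lemma diff_const_bilinear:
  "diff_const (linear_form E y * linear_form E z * P) f =
    (\<Sum>i\<in>E. \<Sum>j\<in>E. y i * z j * diff_const (Var i * Var j * P) f)"
proof -
  have "diff_const (Var i * (linear_form E z * P)) f = (\<Sum>j\<in>E. z j * diff_const (Var i * Var j * P) f)" for i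
  proof -
    have "Var i * (linear_form E z * P) = linear_form E z * (Var i * P)"
      by (rule mult.left_commute)
    moreover have "Var j * (Var i * P) = Var i * Var j * P" for j
      by (simp only: mult.assoc mult.left_commute[of "Var j" "Var i"])
    ultimately show ?thesis by (simp only: diff_const_linear_form)
  qed
  then show ?thesis
    by (simp add: mult.assoc diff_const_linear_form sum_distrib_left)
qed

text \<open>Contracting a loop leaves the empty family, so loops drop out. The remaining indices are
  those with positive row sums, as \<open>symmetric_kernel_nonpos\<close> demands.\<close>

lemma diff_const_bilinear_family:
  assumes ex: "exchange_family E (Suc d) \<B>"
  shows "diff_const (linear_form E y * linear_form E z * P) (family_poly \<B>) =
    (\<Sum>i\<in>\<Union>\<B>. \<Sum>j\<in>\<Union>\<B>. y i * z j * diff_const (Var i * Var j * P) (family_poly \<B>))"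
proof -
  note D = exchange_familyD[OF ex]
  have V: "\<Union>\<B> \<subseteq> E" using D by blast
  have out: "diff_const (Var i * Var j * P) (family_poly \<B>) = 0" if "i \<notin> \<Union>\<B> \<or> j \<notin> \<Union>\<B>" for i j
  proof -
    have "contraction j (contraction i \<B>) = {}"
      using that by (auto simp: contraction_def)
    then show ?thesis by (simp add: diff_const_Var_Var[OF ex])
  qed
  have "(\<Sum>i\<in>E. \<Sum>j\<in>E. y i * z j * diff_const (Var i * Var j * P) (family_poly \<B>)) =
      (\<Sum>i\<in>E. \<Sum>j\<in>\<Union>\<B>. y i * z j * diff_const (Var i * Var j * P) (family_poly \<B>))"
    using V D(1) out by (intro sum.cong refl sum.mono_neutral_right) auto
  also have "\<dots> = (\<Sum>i\<in>\<Union>\<B>. \<Sum>j\<in>\<Union>\<B>. y i * z j * diff_const (Var i * Var j * P) (family_poly \<B>))"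
    by (intro sum.mono_neutral_right V D(1)) (simp add: out)
  finally show ?thesis by (simp only: diff_const_bilinear)
qed

text \<open>Subtracting the multiple \<open>c / w\<close> of \<open>a\<close> moves \<open>x\<close>
  into the hyperplane orthogonal to \<open>a\<close>; expanding the form there gives the reversed
  Cauchy-Schwarz inequality.\<close>

lemma lorentzian_if_hyperplane:
  fixes a :: "'a \<Rightarrow> real" and E :: "'a set"
  defines "A \<equiv> linear_form E a"
  assumes pos: "0 < diff_const (A ^ (n + 2)) f"
    and hyp: "\<And>x. diff_const (linear_form E x * A ^ (n + 1)) f = 0 \<Longrightarrow>
      diff_const (linear_form E x * linear_form E x * A ^ n) f \<le> 0"
  shows "diff_const (linear_form E x * linear_form E x * A ^ n) f * diff_const (A ^ (n + 2)) f
    \<le> (diff_const (linear_form E x * A ^ (n + 1)) f)\<^sup>2"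
proof -
  define u c w where "u = diff_const (linear_form E x * linear_form E x * A ^ n) f"
    and "c = diff_const (linear_form E x * A ^ (n + 1)) f" and "w = diff_const (A ^ (n + 2)) f"
  have w: "w > 0" using pos by (simp add: w_def)
  define t where "t = - c / w"
  have P: "linear_form E x * linear_form E a * A ^ n = linear_form E x * A ^ (n + 1)"
    "linear_form E a * linear_form E a * A ^ n = A ^ (n + 2)"
    "linear_form E a * A ^ (n + 1) = A ^ (n + 2)"
    by (simp_all add: A_def algebra_simps)
  have "diff_const (linear_form E (\<lambda>i. x i + t * a i) * A ^ (n + 1)) f = c + t * w"
    unfolding diff_const_add_scaled P c_def w_def by simp
  also have "\<dots> = 0" using w by (simp add: t_def)
  finally have "u + 2 * t * c + t\<^sup>2 * w \<le> 0"
    using hyp[of "\<lambda>i. x i + t * a i"]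
    unfolding diff_const_square_add_scaled P u_def c_def w_def by simp
  then have "u - c\<^sup>2 / w \<le> 0"
    using w by (simp add: t_def power2_eq_square field_simps)
  then show ?thesis
    using w by (simp add: u_def c_def w_def field_simps)
qed

text \<open>Grouping by the fibres of \<open>g\<close> turns the double sum into a sum of squares of
  fibre sums.\<close>

lemma sum_same_class_nonneg:
  fixes y :: "'a \<Rightarrow> real"
  assumes "finite V"
  shows "0 \<le> (\<Sum>i\<in>V. \<Sum>j\<in>V. if g i = g j then y i * y j else 0)"
proof -
  have inner: "(\<Sum>j\<in>V. if g i = g j then y i * y j else 0) = (\<Sum>j\<in>{j\<in>V. g j = c}. y i * y j)"
    if "g i = c" for i c
    unfolding sum.inter_filter[OF assms] using that by (intro sum.cong) auto
  have "(\<Sum>i\<in>V. \<Sum>j\<in>V. if g i = g j then y i * y j else 0) =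
      (\<Sum>c\<in>g ` V. \<Sum>i\<in>{i\<in>V. g i = c}. \<Sum>j\<in>V. if g i = g j then y i * y j else 0)"
    by (rule sum.image_gen[OF assms])
  also have "\<dots> = (\<Sum>c\<in>g ` V. \<Sum>i\<in>{i\<in>V. g i = c}. \<Sum>j\<in>{i\<in>V. g i = c}. y i * y j)"
    by (intro sum.cong refl inner) auto
  also have "\<dots> = (\<Sum>c\<in>g ` V. (\<Sum>i\<in>{i\<in>V. g i = c}. y i)\<^sup>2)"
    by (simp add: power2_eq_square sum_product)
  also have "\<dots> \<ge> 0" by (simp add: sum_nonneg)
  finally show ?thesis .
qed

text \<open>Every element is compared with a fixed member \<open>B\<close>. If \<open>i\<close> and
  \<open>k\<close> share \<open>B'\<close> and \<open>k\<close> lies outside \<open>B\<close>,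
  exchanging \<open>k\<close> for some \<open>y\<close> in \<open>B\<close> puts \<open>i\<close>
  and \<open>y\<close> into a common member; \<open>d \<ge> 2\<close> provides
  \<open>k\<close>.\<close>

lemma exchange_family_connected:
  assumes ex: "exchange_family E d \<B>" and "d \<ge> 2"
    and z: "\<And>i j B. B \<in> \<B> \<Longrightarrow> i \<in> B \<Longrightarrow> j \<in> B \<Longrightarrow> i \<noteq> j \<Longrightarrow> z i = z j"
  shows "\<exists>c. \<forall>i\<in>\<Union>\<B>. z i = c"
proof (cases "\<B> = {}")
  case False
  then obtain B where B: "B \<in> \<B>" by blast
  note D = exchange_familyD[OF ex]
  obtain b where b: "b \<in> B" using D(4)[OF B] \<open>d \<ge> 2\<close> by fastforce
  have zB: "z k = z b" if "k \<in> B" for k using z[OF B that b] by blast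
  have "z i = z b" if i: "i \<in> B'" "B' \<in> \<B>" for i B'
  proof -
    have "card B' \<ge> 2" using D(4) i \<open>d \<ge> 2\<close> by simp
    then have "B' \<noteq> {i}" by auto
    then obtain k where k: "k \<in> B'" "k \<noteq> i" using i by blast
    show ?thesis
    proof (cases "k \<in> B")
      case True
      then show ?thesis using z[OF i(2,1) k(1) k(2)[symmetric]] zB[OF True] by simp
    next
      case False
      then obtain y where y: "y \<in> B" "y \<notin> B'" "insert y (B' - {k}) \<in> \<B>"
        using exchange_family_exchange[OF ex i(2) B k(1)] by blast
      then have "z i = z y" using z[OF y(3), of i y] i k by blast
      then show ?thesis using zB y by simp
    qed
  qed
  then show ?thesis by blast
qed simp

text \<open>Two non-loops span unless they are parallel, so the form is the square of the coordinate
  sum minus the squared sums over parallel classes.\<close>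

lemma lorentzian_rank_two:
  assumes ex: "exchange_family E 2 \<B>" and a: "\<And>i. i \<in> E \<Longrightarrow> 0 < a i" and "\<B> \<noteq> {}"
    and x: "diff_const (linear_form E x * linear_form E a) (family_poly \<B>) = 0"
  shows "diff_const (linear_form E x * linear_form E x) (family_poly \<B>) \<le> 0"
proof -
  define V where "V = \<Union>\<B>"
  define q where "q y z = diff_const (linear_form E y * linear_form E z) (family_poly \<B>)" for y z
  \<comment> \<open>The parallel class of \<open>i\<close> among the non-loops, used as a label for
    the class.\<close>
  define g where "g i = {j \<in> V. i = j \<or> {i, j} \<notin> \<B>}" for i
  note D = exchange_familyD[OF ex]
  have ex': "exchange_family E (Suc (Suc 0)) \<B>" using ex by (simp add: numeral_2_eq_2)
  have V: "V \<subseteq> E" "finite V" using D by (auto simp: V_def)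
  have adj: "diff_const (Var i * Var j) (family_poly \<B>) = of_bool (i \<noteq> j \<and> {i, j} \<in> \<B>)" for i j
  proof -
    have "diff_const (Var i * Var j) (family_poly \<B>) = of_bool ({} \<in> contraction j (contraction i \<B>))"
      using diff_const_Var_Var[OF ex', of i j 1]
        lookup_zero_family_poly[OF exchange_family_contraction[OF exchange_family_contraction[OF ex']]]
      by (simp add: diff_const_one)
    moreover have "{} \<in> contraction j (contraction i \<B>) \<longleftrightarrow> i \<noteq> j \<and> {i, j} \<in> \<B>"
    proof
      assume "{} \<in> contraction j (contraction i \<B>)"
      then obtain B where B: "B \<in> \<B>" "i \<in> B" "j \<in> B - {i}" "{} = B - {i} - {j}"
        unfolding contraction_def by blast
      then have "B = {i, j}" by blast
      then show "i \<noteq> j \<and> {i, j} \<in> \<B>" using B by blast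
    next
      assume ij: "i \<noteq> j \<and> {i, j} \<in> \<B>"
      then have "{i, j} - {i} \<in> contraction i \<B>" unfolding contraction_def by blast
      moreover have "{i, j} - {i} = {j}" using ij by blast
      ultimately show "{} \<in> contraction j (contraction i \<B>)"
        unfolding contraction_def[of j] by force
    qed
    ultimately show ?thesis by simp
  qed
  \<comment> \<open>Transitivity of parallelism in contrapositive form, obtained by exchanging the
    partner of \<open>j\<close> in a basis for an element of \<open>{i, k}\<close>.\<close>
  have cover: "{i, j} \<in> \<B> \<or> {j, k} \<in> \<B>" if ik: "{i, k} \<in> \<B>" and j: "j \<in> V" for i j k
  proof (cases "j = i \<or> j = k")
    case True
    then show ?thesis using ik by (auto simp: insert_commute)
  next
    case False
    obtain B where B: "B \<in> \<B>" "j \<in> B" using j by (auto simp: V_def)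
    obtain l where l: "B = {j, l}" "l \<noteq> j"
      using D(4)[OF B(1)] B(2) by (auto simp: card_2_iff)
    show ?thesis
    proof (cases "l = i \<or> l = k")
      case True
      then show ?thesis using l B by (auto simp: insert_commute)
    next
      case False
      then obtain y where y: "y \<in> {i, k}" "insert y (B - {l}) \<in> \<B>"
        using exchange_family_exchange[OF ex B(1) ik, of l] l by blast
      have "B - {l} = {j}" using l by blast
      then have "{y, j} \<in> \<B>" using y(2) by (simp only:)
      then show ?thesis using y(1) by (cases "y = i") (simp_all add: insert_commute[of j k])
    qed
  qed
  have g: "g i = g j \<longleftrightarrow> i = j \<or> {i, j} \<notin> \<B>" if "i \<in> V" "j \<in> V" for i j
  proof
    assume "g i = g j"
    moreover have "j \<in> g j" using that by (simp add: g_def)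
    ultimately show "i = j \<or> {i, j} \<notin> \<B>" by (auto simp: g_def)
  next
    assume ij: "i = j \<or> {i, j} \<notin> \<B>"
    show "g i = g j"
    proof (cases "i = j")
      case False
      then have "{i, j} \<notin> \<B>" "{j, i} \<notin> \<B>" using ij by (auto simp: insert_commute)
      then have "{i, k} \<in> \<B> \<longleftrightarrow> {j, k} \<in> \<B>" if "k \<in> V" for k
        using cover[of i k j] cover[of j k i] \<open>i \<in> V\<close> \<open>j \<in> V\<close> by blast
      then show ?thesis using \<open>{i, j} \<notin> \<B>\<close> \<open>{j, i} \<notin> \<B>\<close> by (auto simp: g_def)
    qed simp
  qed
  have q_eq: "q y y = (sum y V)\<^sup>2 - (\<Sum>i\<in>V. \<Sum>j\<in>V. if g i = g j then y i * y j else 0)" for y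
  proof -
    have "q y y = (\<Sum>i\<in>V. \<Sum>j\<in>V. y i * y j * of_bool (i \<noteq> j \<and> {i, j} \<in> \<B>))"
      using diff_const_bilinear_family[OF ex', of y y 1] by (simp add: q_def V_def adj)
    also have "\<dots> = (\<Sum>i\<in>V. \<Sum>j\<in>V. y i * y j - (if g i = g j then y i * y j else 0))"
      by (intro sum.cong refl) (simp add: g)
    finally show ?thesis
      by (simp add: sum_subtractf power2_eq_square sum_product)
  qed
  have hyper: "q y y \<le> 0" if "sum y V = 0" for y
    using sum_same_class_nonneg[OF V(2), of g y] q_eq[of y] that by simp
  obtain B where B: "B \<in> \<B>" using \<open>\<B> \<noteq> {}\<close> by blast
  have "B \<noteq> {}" using D(4)[OF B] by auto
  then have "sum a V > 0"
    using V a B by (intro sum_pos) (auto simp: V_def)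
  \<comment> \<open>The form is nonpositive where the coordinate sum vanishes, so \<open>x\<close>
    is shifted there along \<open>a\<close>. The cross term is zero by assumption, and the added
    square \<open>t\<^sup>2 * q a a\<close> is nonnegative.\<close>
  define t where "t = - sum x V / sum a V"
  have "(\<Sum>i\<in>V. x i + t * a i) = sum x V + t * sum a V"
    by (simp add: sum.distrib sum_distrib_left)
  also have "\<dots> = 0" using \<open>sum a V > 0\<close> by (simp add: t_def)
  finally have "q (\<lambda>i. x i + t * a i) (\<lambda>i. x i + t * a i) \<le> 0"
    by (rule hyper)
  then have "q x x + t\<^sup>2 * q a a \<le> 0"
    using diff_const_square_add_scaled[of E x t a 1] x by (simp add: q_def)
  moreover have "0 \<le> q a a"
    using diff_const_power_nonneg[OF ex, of a] a less_imp_le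
    by (auto simp: q_def power2_eq_square)
  ultimately show ?thesis by (smt (verit) mult_nonneg_nonneg q_def zero_le_power2)
qed

text \<open>Induction over contractions. The inequalities for all contractions supply the hypothesis
  \<open>hyp\<close> of \<open>symmetric_kernel_nonpos\<close>, whose conclusion is nonpositivity on
  the hyperplane.\<close>

lemma lorentzian_positive:
  assumes "exchange_family E (n + 2) \<B>" "\<And>i. i \<in> E \<Longrightarrow> 0 < a i"
  shows "diff_const (linear_form E x * linear_form E x * linear_form E a ^ n) (family_poly \<B>) *
      diff_const (linear_form E a ^ (n + 2)) (family_poly \<B>)
    \<le> (diff_const (linear_form E x * linear_form E a ^ (n + 1)) (family_poly \<B>))\<^sup>2"
  using assms(1)
proof (induction n arbitrary: \<B> x)
  case 0
  show ?case
  proof (cases "\<B> = {}")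
    case False
    then obtain B where B: "B \<in> \<B>" by blast
    have "0 < diff_const (linear_form E a ^ (0 + 2)) (family_poly \<B>)"
      using exchange_familyD(3)[OF 0 B] assms(2) less_imp_le
      by (intro diff_const_power_pos[OF 0 _ B]) auto
    moreover have "exchange_family E 2 \<B>" using 0 by (simp add: numeral_2_eq_2)
    ultimately show ?thesis
      by (intro lorentzian_if_hyperplane)
         (use lorentzian_rank_two[of E \<B> a] False assms(2) in auto)
  qed simp
next
  case (Suc n)
  note ex = Suc.prems
  define f where "f = family_poly \<B>"
  define A where "A = linear_form E a"
  define V where "V = \<Union>\<B>"
  define dd where "dd i j = diff_const (Var i * Var j * A ^ (n + 1)) f" for i j
  have ex': "exchange_family E (Suc (n + 2)) \<B>" "exchange_family E (Suc (Suc (n + 1))) \<B>"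
    using ex by simp_all
  note exC = exchange_family_contraction[OF ex'(1)]
  note D = exchange_familyD[OF ex]
  have V: "V \<subseteq> E" "finite V" using D by (auto simp: V_def)
  have apos: "0 < a i" if "i \<in> V" for i using that V assms(2) by blast
  have Pow: "A * A ^ m = A ^ (m + 1)" for m by simp
  have bilin: "diff_const (linear_form E y * linear_form E z * A ^ (n + 1)) f =
      (\<Sum>i\<in>V. \<Sum>j\<in>V. y i * z j * dd i j)" for y z
    unfolding f_def V_def dd_def by (rule diff_const_bilinear_family[OF ex'(1)])
  have lin: "diff_const (linear_form E y * P) f = (\<Sum>i\<in>V. y i * diff_const P (family_poly (contraction i \<B>)))" for y P
    unfolding diff_const_linear_form f_def diff_const_Var_family[OF ex]
    using V D(1) contraction_eq_empty[of _ \<B>] by (intro sum.mono_neutral_right) (auto simp: V_def)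
  have dd_sym: "dd i j = dd j i" for i j by (simp add: dd_def mult.commute[of "Var i"])
  have dd_contr: "dd i j = diff_const (Var j * A ^ (n + 1)) (family_poly (contraction i \<B>))" for i j
    by (simp only: dd_def f_def mult.assoc diff_const_Var_family[OF ex])
  have dd_nonneg: "0 \<le> dd i j" for i j
    unfolding dd_def f_def diff_const_Var_Var[OF ex'(1)] A_def
    using assms(2) less_imp_le
    by (intro diff_const_power_nonneg exchange_family_contraction ex'(2)) auto
  have dd_pos: "0 < dd i j" if "B \<in> \<B>" "i \<in> B" "j \<in> B" "i \<noteq> j" for B i j
    unfolding dd_def f_def diff_const_Var_Var[OF ex'(1)] A_def
    using assms(2) less_imp_le that D(3)[OF that(1)]
    by (intro diff_const_power_pos[where B = "B - {i} - {j}"] exchange_family_contraction ex'(2))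
       (auto simp: contraction_def)
  define w where "w i = diff_const (A ^ (n + 2)) (family_poly (contraction i \<B>))" for i
  have w_pos: "0 < w i" if i: "i \<in> V" for i
  proof -
    obtain B where B: "B \<in> \<B>" "i \<in> B" using i by (auto simp: V_def)
    show ?thesis unfolding w_def A_def
      using assms(2) less_imp_le B D(3)[OF B(1)]
      by (intro diff_const_power_pos[OF exC, where B = "B - {i}"]) (auto simp: contraction_def)
  qed
  \<comment> \<open>Operators commute, so contracting by \<open>i\<close> first reads off the row of
    \<open>i\<close> in the symmetric matrix \<open>dd\<close>.\<close>
  have row: "diff_const (linear_form E y * A ^ (n + 1)) (family_poly (contraction i \<B>)) = (\<Sum>j\<in>V. y j * dd i j)" for y i
  proof -
    have "Var i * (linear_form E y * A ^ (n + 1)) = linear_form E y * (Var i * A ^ (n + 1))"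
      by (rule mult.left_commute)
    then have "diff_const (linear_form E y * A ^ (n + 1)) (family_poly (contraction i \<B>)) =
        diff_const (linear_form E y * (Var i * A ^ (n + 1))) f"
      using diff_const_Var_family[OF ex, of i] by (metis f_def)
    also have "\<dots> = (\<Sum>j\<in>V. y j * dd i j)"
      unfolding lin dd_contr[symmetric] by (simp only: dd_sym)
    finally show ?thesis .
  qed
  have w_row: "w i = (\<Sum>j\<in>V. a j * dd i j)" for i
    using row[of a i] by (simp add: w_def A_def)
  have hyper: "diff_const (linear_form E x * linear_form E x * A ^ (n + 1)) f \<le> 0"
    if x: "diff_const (linear_form E x * A ^ (n + 2)) f = 0" for x
  proof -
    \<comment> \<open>The substitution \<open>x i = a i * z i\<close> makes the row sums of the
      kernel equal to \<open>a i * w i\<close>. The absolute values ensure nonnegativity at all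
      indices and change nothing on \<open>V\<close>.\<close>
    let ?K = "\<lambda>i j. \<bar>a i\<bar> * \<bar>a j\<bar> * dd i j" and ?z = "\<lambda>i. x i / a i"
    have "(\<Sum>i\<in>V. \<Sum>j\<in>V. ?K i j * ?z i * ?z j) \<le> 0"
    proof (rule symmetric_kernel_nonpos[where m = "\<lambda>i. a i * w i"])
      show "finite V" by (rule V)
      show "?K i j = ?K j i" for i j by (simp add: dd_sym[of i j])
      show "0 \<le> ?K i j" for i j by (simp add: dd_nonneg)
      show "a i * w i = (\<Sum>j\<in>V. ?K i j)" if "i \<in> V" for i
        unfolding w_row sum_distrib_left
        by (intro sum.cong refl) (use apos that in \<open>simp add: abs_of_pos\<close>)
      show "0 < a i * w i" if "i \<in> V" for i using that apos w_pos by simp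
      show "\<exists>c. \<forall>i\<in>V. z i = c"
        if z: "\<And>i j. i \<in> V \<Longrightarrow> j \<in> V \<Longrightarrow> 0 < ?K i j \<Longrightarrow> z i = z j" for z :: "'a \<Rightarrow> real"
        unfolding V_def
      proof (rule exchange_family_connected[OF ex])
        show "z i = z j" if "B \<in> \<B>" "i \<in> B" "j \<in> B" "i \<noteq> j" for i j B
        proof (rule z)
          show ij: "i \<in> V" "j \<in> V" using that by (auto simp: V_def)
          show "0 < ?K i j" using dd_pos[OF that] apos[OF ij(1)] apos[OF ij(2)] by simp
        qed
      qed simp
      show "(\<Sum>i\<in>V. a i * w i * ?z i) = 0"
      proof -
        have "(\<Sum>i\<in>V. a i * w i * ?z i) = (\<Sum>i\<in>V. x i * w i)"
          by (intro sum.cong refl) (use apos in force)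
        then show ?thesis using x by (simp add: lin w_def)
      qed
      show "(\<Sum>i\<in>V. \<Sum>j\<in>V. ?K i j * z i * z j) \<le> (\<Sum>i\<in>V. (\<Sum>j\<in>V. ?K i j * z j)\<^sup>2 / (a i * w i))" for z
      proof -
        let ?y = "\<lambda>i. a i * z i"
        have "(\<Sum>i\<in>V. \<Sum>j\<in>V. ?K i j * z i * z j) = (\<Sum>i\<in>V. \<Sum>j\<in>V. ?y i * ?y j * dd i j)"
          by (intro sum.cong refl) (use apos in \<open>simp add: abs_of_pos\<close>)
        also have "\<dots> = diff_const (linear_form E ?y * linear_form E ?y * A ^ (n + 1)) f"
          by (simp only: bilin)
        \<comment> \<open>One factor \<open>linear_form E a\<close> is spent on contractions,
          leaving for each \<open>i\<close> the form to which the induction hypothesis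
          applies.\<close>
        also have "linear_form E ?y * linear_form E ?y * A ^ (n + 1) =
            linear_form E a * (linear_form E ?y * linear_form E ?y * A ^ n)"
          by (simp add: A_def)
        also have "diff_const \<dots> f = (\<Sum>i\<in>V. a i * diff_const (linear_form E ?y * linear_form E ?y * A ^ n)
            (family_poly (contraction i \<B>)))"
          by (rule lin)
        also have "\<dots> \<le> (\<Sum>i\<in>V. (\<Sum>j\<in>V. ?K i j * z j)\<^sup>2 / (a i * w i))"
        proof (rule sum_mono)
          fix i assume i: "i \<in> V"
          let ?q = "diff_const (linear_form E ?y * linear_form E ?y * A ^ n) (family_poly (contraction i \<B>))"
          have "?q * w i \<le> (\<Sum>j\<in>V. ?y j * dd i j)\<^sup>2"
            using Suc.IH[OF exC[of i], of ?y] unfolding w_def row[symmetric] A_def .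
          then have "?q \<le> (\<Sum>j\<in>V. ?y j * dd i j)\<^sup>2 / w i"
            using w_pos[OF i] by (simp add: field_simps)
          then have "a i * ?q \<le> a i * ((\<Sum>j\<in>V. ?y j * dd i j)\<^sup>2 / w i)"
            using apos[OF i] by (intro mult_left_mono) auto
          also have "\<dots> = (a i * (\<Sum>j\<in>V. ?y j * dd i j))\<^sup>2 / (a i * w i)"
            using apos[OF i] by (simp add: power_mult_distrib power2_eq_square)
          also have "a i * (\<Sum>j\<in>V. ?y j * dd i j) = (\<Sum>j\<in>V. ?K i j * z j)"
            unfolding sum_distrib_left
            by (intro sum.cong refl) (use apos i in \<open>simp add: abs_of_pos\<close>)
          finally show "a i * ?q \<le> (\<Sum>j\<in>V. ?K i j * z j)\<^sup>2 / (a i * w i)" .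
        qed
        finally show ?thesis .
      qed
    qed
    also have "(\<Sum>i\<in>V. \<Sum>j\<in>V. ?K i j * ?z i * ?z j) = (\<Sum>i\<in>V. \<Sum>j\<in>V. x i * x j * dd i j)"
      by (intro sum.cong refl) (use apos in \<open>force simp: abs_of_pos\<close>)
    finally show ?thesis by (simp only: bilin)
  qed
  show ?case
  proof (cases "\<B> = {}")
    case False
    then obtain B where B: "B \<in> \<B>" by blast
    have "0 < diff_const (linear_form E a ^ (Suc n + 2)) (family_poly \<B>)"
      using D(3)[OF B] assms(2) less_imp_le
      by (intro diff_const_power_pos[OF ex _ B]) auto
    then show ?thesis
      by (rule lorentzian_if_hyperplane) (use hyper in \<open>simp add: A_def f_def\<close>)
  qed simp
qed

text \<open>All weights are raised by \<open>t > 0\<close> and \<open>t\<close> tends to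
  zero.\<close>

lemma lorentzian_nonneg:
  assumes "exchange_family E (n + 2) \<B>" "\<And>i. i \<in> E \<Longrightarrow> 0 \<le> a i"
  shows "diff_const (linear_form E x * linear_form E x * linear_form E a ^ n) (family_poly \<B>) *
      diff_const (linear_form E a ^ (n + 2)) (family_poly \<B>)
    \<le> (diff_const (linear_form E x * linear_form E a ^ (n + 1)) (family_poly \<B>))\<^sup>2"
proof -
  define A where "A t = linear_form E (\<lambda>i. a i + t * 1)" for t
  define F where "F t = (diff_const (linear_form E x * A t ^ (n + 1)) (family_poly \<B>))\<^sup>2
    - diff_const (linear_form E x * linear_form E x * A t ^ n) (family_poly \<B>) *
      diff_const (1 * A t ^ (n + 2)) (family_poly \<B>)" for t
  have "isCont F 0"
    unfolding F_def[abs_def] A_def by (intro continuous_intros isCont_diff_const_power)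
  then have "(F \<longlongrightarrow> F 0) (at_right 0)"
    by (simp add: isCont_def filterlim_at_split)
  moreover have "0 \<le> F t" if "t > 0" for t
    using lorentzian_positive[OF assms(1), of "\<lambda>i. a i + t * 1" x] assms(2) that
    by (simp add: F_def A_def add_nonneg_pos)
  then have "eventually (\<lambda>t. 0 \<le> F t) (at_right 0)"
    by (simp add: eventually_at_filter)
  ultimately have "0 \<le> F 0"
    by (rule tendsto_lowerbound) simp
  then show ?thesis by (simp add: F_def A_def)
qed

section \<open>Strictness on the facet\<close>

text \<open>The property of not being a coloop survives contraction by a non-loop
  \<open>j \<noteq> e\<close>: in a member with \<open>j\<close> and \<open>e\<close>, exchange
  \<open>e\<close> for an element of \<open>B\<close>.\<close>

lemma exchange_family_contraction_avoiding:
  assumes "exchange_family E d \<B>" "B \<in> \<B>" "e \<notin> B" "B' \<in> \<B>" "j \<in> B'" "j \<noteq> e"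
  obtains C where "C \<in> contraction j \<B>" "e \<notin> C"
proof (cases "e \<in> B'")
  case False
  then show ?thesis using assms that[of "B' - {j}"] by (auto simp: contraction_def)
next
  case True
  then obtain y where y: "y \<in> B" "insert y (B' - {e}) \<in> \<B>"
    using exchange_family_exchange[OF assms(1,4,2) True assms(3)] by blast
  have "insert y (B' - {e}) - {j} \<in> contraction j \<B>"
    using y assms unfolding contraction_def by blast
  then show ?thesis using that[of "insert y (B' - {e}) - {j}"] y assms by blast
qed

text \<open>A combination of first derivatives of a squarefree form is again squarefree and
  homogeneous, so single derivatives detect its monomials.\<close>

lemma keys_diff_act_linear_form:
  assumes ex: "exchange_family E (Suc d) \<B>"
    and m: "m \<in> Poly_Mapping.keys (diff_act (linear_form E x) (family_poly \<B>))"
  obtains S where "S \<subseteq> E" "card S = d" "m = indicator_monom S"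
proof -
  have "diff_act (linear_form E x) (family_poly \<B>) = (\<Sum>j\<in>E. Const (x j) * family_poly (contraction j \<B>))"
    using diff_act_linear_form[of E x 1 "family_poly \<B>"]
    by (simp add: pdiff_exchange_family[OF ex] diff_act_Const[of 1, unfolded Const_def, simplified])
  then have "(\<Sum>j\<in>E. x j * Poly_Mapping.lookup (family_poly (contraction j \<B>)) m) \<noteq> 0"
    using m by (simp add: in_keys_iff lookup_sum)
  then obtain j where "Poly_Mapping.lookup (family_poly (contraction j \<B>)) m \<noteq> 0"
    by (metis (no_types, lifting) mult_zero_right sum.neutral)
  then obtain S where "S \<in> contraction j \<B>" "m = indicator_monom S"
    using exchange_familyD[OF exchange_family_contraction[OF ex, of j]]
    by (auto simp: lookup_family_poly split: if_splits)
  then show ?thesis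
    using that exchange_familyD[OF exchange_family_contraction[OF ex, of j]] by blast
qed

lemma indicator_monom_remove:
  assumes "finite S" "j \<in> S"
  shows "indicator_monom (S - {j}) + Poly_Mapping.single j 1 = indicator_monom S"
  using assms by (simp add: indicator_monom_def sum.remove[of S j] add.commute)

lemma linear_form_indicator:
  assumes "finite E" "j \<in> E"
  shows "linear_form E (\<lambda>i. if i = j then 1 else 0) = Var j"
proof -
  have "linear_form E (\<lambda>i. if i = j then 1 else 0) = (\<Sum>i\<in>E. if i = j then Var i else 0)"
    unfolding linear_form_def by (intro sum.cong) (auto simp: Const_def)
  then show ?thesis using assms by simp
qed

lemma lorentzian_nonpos:
  assumes ex: "exchange_family E (n + 2) \<B>" and a: "\<And>i. i \<in> E \<Longrightarrow> 0 \<le> a i"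
    and pos: "0 < diff_const (linear_form E a ^ (n + 2)) (family_poly \<B>)"
    and x: "diff_const (linear_form E x * linear_form E a ^ (n + 1)) (family_poly \<B>) = 0"
  shows "diff_const (linear_form E x * linear_form E x * linear_form E a ^ n) (family_poly \<B>) \<le> 0"
  using lorentzian_nonneg[where a = a and x = x, OF ex a] pos x by (simp add: mult_le_0_iff)

text \<open>The inequality at \<open>x + t y\<close> has zero constant term, and its right side is
  of order \<open>t\<^sup>2\<close>; hence the linear term vanishes. Here \<open>y\<close> is not
  confined to the hyperplane.\<close>

lemma lorentzian_kernel:
  assumes ex: "exchange_family E (n + 2) \<B>" and a: "\<And>i. i \<in> E \<Longrightarrow> 0 \<le> a i"
    and pos: "0 < diff_const (linear_form E a ^ (n + 2)) (family_poly \<B>)"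
    and x: "diff_const (linear_form E x * linear_form E a ^ (n + 1)) (family_poly \<B>) = 0"
      "diff_const (linear_form E x * linear_form E x * linear_form E a ^ n) (family_poly \<B>) = 0"
  shows "diff_const (linear_form E x * linear_form E y * linear_form E a ^ n) (family_poly \<B>) = 0"
proof -
  define A where "A = linear_form E a"
  define b c q w where "b = diff_const (linear_form E x * linear_form E y * A ^ n) (family_poly \<B>)"
    and "c = diff_const (linear_form E y * A ^ (n + 1)) (family_poly \<B>)"
    and "q = diff_const (linear_form E y * linear_form E y * A ^ n) (family_poly \<B>)"
    and "w = diff_const (A ^ (n + 2)) (family_poly \<B>)"
  have "2 * b * w = 0"
  proof (rule linear_le_quadratic_imp_zero)
    fix t
    have "(2 * t * b + t\<^sup>2 * q) * w \<le> (t * c)\<^sup>2"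
      using lorentzian_nonneg[where a = a and x = "\<lambda>i. x i + t * y i", OF ex a] x
      unfolding diff_const_square_add_scaled diff_const_add_scaled
      by (simp add: A_def b_def c_def q_def w_def)
    then show "t * (2 * b * w) \<le> t\<^sup>2 * (c\<^sup>2 - q * w)"
      by (simp add: algebra_simps power_mult_distrib)
  qed
  then show ?thesis using pos by (simp add: b_def w_def A_def)
qed

text \<open>The contrapositive of strict negativity, in a form suited to induction: primitivity
  enters only through one number, which the kernel property passes on to contractions.\<close>

lemma hodge_riemann_strict:
  assumes "exchange_family E (n + 2) \<B>" "\<And>i. i \<in> E \<Longrightarrow> i \<noteq> e \<Longrightarrow> 0 < a i" "a e = 0"
    and "B \<in> \<B>" "e \<notin> B"
    and "diff_const (linear_form E x * linear_form E a ^ (n + 1)) (family_poly \<B>) = 0"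
    and "0 \<le> diff_const (linear_form E x * linear_form E x * linear_form E a ^ n) (family_poly \<B>)"
  shows "diff_act (linear_form E x) (family_poly \<B>) = 0"
  using assms(1,4-)
proof (induction n arbitrary: \<B> B)
  case (0 \<B> B)
  note ex = 0(1)
  note D = exchange_familyD[OF ex]
  have a: "0 \<le> a i" if "i \<in> E" for i using assms(2)[OF that] assms(3) by (cases "i = e") auto
  have pos: "0 < diff_const (linear_form E a ^ (0 + 2)) (family_poly \<B>)"
    using 0 D(3)[OF 0(2)] assms(2) a by (intro diff_const_power_pos[OF ex _ 0(2)]) auto
  have sq: "diff_const (linear_form E x * linear_form E x * linear_form E a ^ 0) (family_poly \<B>) = 0"
    using lorentzian_nonpos[OF ex a pos 0(4)] 0(5) by simp
  let ?g = "diff_act (linear_form E x) (family_poly \<B>)"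
  \<comment> \<open>In rank two \<open>?g\<close> is a linear polynomial, and pairing with the
    \<open>j\<close>-th unit vector in the kernel statement gives its coefficient at
    \<open>j\<close>.\<close>
  have lin: "Poly_Mapping.lookup (pdiff j ?g) 0 = 0" if "j \<in> E" for j
    using lorentzian_kernel[OF ex a pos 0(4) sq, of "\<lambda>i. if i = j then 1 else 0"] that D(1)
    by (simp add: linear_form_indicator diff_const_def mult.commute[of _ "Var j"] diff_act_mult diff_act_Var)
  have "Poly_Mapping.keys ?g = {}"
  proof (rule equals0I)
    fix m assume m: "m \<in> Poly_Mapping.keys ?g"
    have "exchange_family E (Suc 1) \<B>" using ex by simp
    then obtain S where S: "S \<subseteq> E" "card S = 1" "m = indicator_monom S"
      using keys_diff_act_linear_form m by blast
    then obtain j where "S = {j}" by (auto simp: card_1_singleton_iff)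
    then have "m = Poly_Mapping.single j 1" "j \<in> E"
      using S by (auto simp: indicator_monom_def)
    then show False using lin[of j] m by (simp add: lookup_pdiff in_keys_iff)
  qed
  then show ?case by simp
next
  case (Suc n \<B> B)
  note ex = Suc.prems(1)
  note D = exchange_familyD[OF ex]
  have ex': "exchange_family E (Suc (n + 2)) \<B>" using ex by simp
  note exC = exchange_family_contraction[OF ex']
  have a: "0 \<le> a i" if "i \<in> E" for i using assms(2)[OF that] assms(3) by (cases "i = e") auto
  have pos: "0 < diff_const (linear_form E a ^ (Suc n + 2)) (family_poly \<B>)"
    using Suc.prems(3) D(3)[OF Suc.prems(2)] assms(2) a
    by (intro diff_const_power_pos[OF ex _ Suc.prems(2)]) auto
  have sq: "diff_const (linear_form E x * linear_form E x * linear_form E a ^ Suc n) (family_poly \<B>) = 0"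
    using lorentzian_nonpos[OF ex a pos Suc.prems(4)] Suc.prems(5) by linarith
  let ?q = "\<lambda>j. diff_const (linear_form E x * linear_form E x * linear_form E a ^ n) (family_poly (contraction j \<B>))"
  have avoid: "\<exists>C\<in>contraction j \<B>. e \<notin> C" if "j \<in> \<Union>\<B>" "j \<noteq> e" for j
    using that exchange_family_contraction_avoiding[OF ex Suc.prems(2,3)] by blast
  have lin: "diff_const (linear_form E x * linear_form E a ^ (n + 1)) (family_poly (contraction j \<B>)) = 0"
    if "j \<in> E" for j
  proof -
    have eq: "linear_form E x * Var j * linear_form E a ^ Suc n = Var j * (linear_form E x * linear_form E a ^ (n + 1))"
      by (simp add: algebra_simps)
    show ?thesis
      using lorentzian_kernel[OF ex a pos Suc.prems(4) sq, of "\<lambda>i. if i = j then 1 else 0"]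
      unfolding linear_form_indicator[OF D(1) that] eq diff_const_Var_family[OF ex] .
  qed
  have nonpos: "?q j \<le> 0" if j: "j \<in> E" "j \<noteq> e" for j
  proof (cases "j \<in> \<Union>\<B>")
    case True
    then obtain C where C: "C \<in> contraction j \<B>" "e \<notin> C" using avoid j by blast
    show ?thesis
    proof (rule lorentzian_nonpos[OF exC a _ lin])
      show "0 < diff_const (linear_form E a ^ (n + 2)) (family_poly (contraction j \<B>))"
        using C exchange_familyD(3)[OF exC C(1)] assms(2) a
        by (intro diff_const_power_pos[OF exC _ C(1)]) auto
    qed (use j in auto)
  next
    case False
    then show ?thesis by (simp add: contraction_eq_empty)
  qed
  have "linear_form E x * linear_form E x * linear_form E a ^ Suc n =
      linear_form E a * (linear_form E x * linear_form E x * linear_form E a ^ n)"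
    by simp
  \<comment> \<open>Peeling off one factor expresses the vanishing form as a sum of terms that are
    nonpositive for \<open>j \<noteq> e\<close> and zero for \<open>j = e\<close>; so each term
    vanishes.\<close>
  then have "(\<Sum>j\<in>E. a j * ?q j) = 0"
    using sq by (simp only: diff_const_linear_form diff_const_Var_family[OF ex])
  then have "(\<Sum>j\<in>E. - (a j * ?q j)) = 0" by (simp add: sum_negf)
  moreover have "0 \<le> - (a j * ?q j)" if "j \<in> E" for j
    using nonpos[OF that] a[OF that] assms(3) by (cases "j = e") (auto intro: mult_nonneg_nonpos)
  ultimately have zero: "a j * ?q j = 0" if "j \<in> E" for j
    using that D(1) by (simp add: sum_nonneg_eq_0_iff)
  let ?g = "diff_act (linear_form E x) (family_poly \<B>)"
  have pd: "pdiff j ?g = 0" if j: "j \<in> E" "j \<noteq> e" for j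
  proof -
    have "pdiff j ?g = diff_act (linear_form E x) (family_poly (contraction j \<B>))"
      by (metis diff_act_mult diff_act_Var_mult diff_act_Var pdiff_exchange_family[OF ex])
    also have "\<dots> = 0"
    proof (cases "j \<in> \<Union>\<B>")
      case True
      then obtain C where C: "C \<in> contraction j \<B>" "e \<notin> C" using avoid j by blast
      have "0 \<le> ?q j" using zero[OF j(1)] assms(2)[OF j] by simp
      then show ?thesis by (intro Suc.IH[OF exC C lin[OF j(1)]])
    next
      case False
      then show ?thesis by (simp add: contraction_eq_empty)
    qed
    finally show ?thesis .
  qed
  have "Poly_Mapping.keys ?g = {}"
  proof (rule equals0I)
    fix m assume m: "m \<in> Poly_Mapping.keys ?g"
    obtain S where S: "S \<subseteq> E" "card S = n + 2" "m = indicator_monom S"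
      using keys_diff_act_linear_form[OF ex' m] by blast
    then have "finite S" using D(1) finite_subset by blast
    \<comment> \<open>Each monomial of \<open>?g\<close> is squarefree of degree at least two, so it
      contains a variable other than \<open>e\<close>, whose derivative would be nonzero.\<close>
    have "\<not> S \<subseteq> {e}"
      using S(2) card_mono[of "{e}" S] by auto
    then obtain j where j: "j \<in> S" "j \<noteq> e" by blast
    then have "pdiff j ?g = 0" using S pd by blast
    then have "Poly_Mapping.lookup (pdiff j ?g) (indicator_monom (S - {j})) = 0" by simp
    then have "Poly_Mapping.lookup ?g m = 0"
      unfolding lookup_pdiff indicator_monom_remove[OF \<open>finite S\<close> j(1)] S(3)
      by (simp add: add_nonneg_eq_0_iff)
    then show False using m by (simp add: in_keys_iff)
  qed
  then show ?case by simp
qed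

text \<open>Every monomial contains \<open>e\<close>, so a term that differentiates it completely
  must use the derivative by \<open>e\<close>, which has weight zero.\<close>

lemma diff_act_power_eq_0:
  assumes "exchange_family E d \<B>" "a e = 0" "\<And>B. B \<in> \<B> \<Longrightarrow> e \<in> B"
  shows "diff_act (linear_form E a ^ d) (family_poly \<B>) = 0"
  using assms(1,3)
proof (induction d arbitrary: \<B>)
  case (0 \<B>)
  then have "\<B> = {}" using exchange_familyD(4,5)[OF 0(1)] by fastforce
  then show ?case by simp
next
  case (Suc d \<B>)
  have "Const (a i) * diff_act (linear_form E a ^ d) (pdiff i (family_poly \<B>)) = 0" for i
  proof (cases "i = e")
    case True
    then show ?thesis using assms(2) by (simp add: Const_def)
  next
    case False
    then have "diff_act (linear_form E a ^ d) (family_poly (contraction i \<B>)) = 0"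
      using Suc.prems
      by (intro Suc.IH exchange_family_contraction) (auto simp: contraction_def)
    then show ?thesis by (simp add: pdiff_exchange_family[OF Suc.prems(1)])
  qed
  then show ?case by (simp add: diff_act_linear_form)
qed

section \<open>Matroids\<close>

context matroid
begin

lemma finite_indep: "finite \<I>"
  using finite_ground indep_subset_ground by (intro finite_subset[of \<I> "Pow E"]) auto

lemma finite_indep_set: "X \<in> \<I> \<Longrightarrow> finite X"
  using finite_ground indep_subset_ground finite_subset by blast

lemma card_indep_le_rank: "X \<in> \<I> \<Longrightarrow> card X \<le> matroid_rank \<I>"
  unfolding matroid_rank_def using finite_indep by simp

lemma basesI:
  assumes "X \<in> \<I>" "card X = matroid_rank \<I>"
  shows "X \<in> bases \<I>"
proof -
  have "Y = X" if "Y \<in> \<I>" "X \<subseteq> Y" for Y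
    using card_subset_eq[OF finite_indep_set[OF that(1)] that(2)] card_indep_le_rank[OF that(1)]
      card_mono[OF finite_indep_set[OF that(1)] that(2)] assms(2) by simp
  then show ?thesis using assms by (simp add: bases_def)
qed

lemma ex_max_indep: "\<exists>X\<in>\<I>. card X = matroid_rank \<I>"
proof -
  have "matroid_rank \<I> \<in> card ` \<I>"
    unfolding matroid_rank_def using finite_indep indep_empty by (intro Max_in) auto
  then show ?thesis by auto
qed

lemma bases_nonempty: "bases \<I> \<noteq> {}"
  using ex_max_indep basesI by blast

lemma card_basis:
  assumes "B \<in> bases \<I>"
  shows "card B = matroid_rank \<I>"
proof (rule ccontr)
  assume neq: "card B \<noteq> matroid_rank \<I>"
  have B: "B \<in> \<I>" "\<And>Y. Y \<in> \<I> \<Longrightarrow> B \<subseteq> Y \<Longrightarrow> Y = B" using assms by (auto simp: bases_def)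
  obtain X where "X \<in> \<I>" "card B < card X"
    using ex_max_indep neq card_indep_le_rank[OF B(1)] by force
  then obtain y where "y \<in> X - B" "insert y B \<in> \<I>" using indep_augment B(1) by blast
  then show False using B(2)[of "insert y B"] by blast
qed

text \<open>Augmenting \<open>A - {x}\<close> from \<open>B\<close> yields \<open>y\<close>; it lies
  outside \<open>A\<close> because \<open>x\<close> is not in \<open>B\<close>, and the result has
  the cardinality of a basis.\<close>

lemma exchange_family_bases: "exchange_family E (matroid_rank \<I>) (bases \<I>)"
proof -
  have "\<exists>y\<in>B - A. insert y (A - {x}) \<in> bases \<I>"
    if A: "A \<in> bases \<I>" and B: "B \<in> bases \<I>" and x: "x \<in> A - B" for A B x
  proof -
    have I: "A \<in> \<I>" "B \<in> \<I>" using A B by (auto simp: bases_def)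
    have fin: "finite A" using finite_indep_set I by blast
    then have "card (A - {x}) < card B"
      using x card_basis[OF A] card_basis[OF B] card_Diff1_less[of A x] by auto
    then obtain y where y: "y \<in> B - (A - {x})" "insert y (A - {x}) \<in> \<I>"
      using indep_augment[OF indep_subset[OF I(1)] I(2), of "A - {x}"] by blast
    then have yA: "y \<in> B - A" using x by blast
    then have "card (insert y (A - {x})) = matroid_rank \<I>"
      using fin x card_basis[OF A] card_Suc_Diff1[of A x] by simp
    then show ?thesis using basesI y(2) yA by blast
  qed
  moreover have "B \<subseteq> E \<and> card B = matroid_rank \<I>" if "B \<in> bases \<I>" for B
    using that card_basis indep_subset_ground by (auto simp: bases_def)
  ultimately show ?thesis
    using finite_ground by (simp add: exchange_family_def)
qed

end

lemma basis_gen_poly_eq_family_poly: "basis_gen_poly \<I> = family_poly (bases \<I>)"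
  by (simp add: basis_gen_poly_def family_poly_def)

section \<open>Passage to the quotient algebra\<close>

lemma diff_ring_simps [simp]:
  "\<xi> \<otimes>\<^bsub>diff_ring E\<^esub> \<eta> = \<xi> * \<eta>" "\<one>\<^bsub>diff_ring E\<^esub> = 1" "\<xi> \<oplus>\<^bsub>diff_ring E\<^esub> \<eta> = \<xi> + \<eta>" "\<zero>\<^bsub>diff_ring E\<^esub> = 0"
  by (simp_all add: diff_ring_def)

lemma mult_in_diff_ring:
  "\<xi> \<in> carrier (diff_ring E) \<Longrightarrow> \<eta> \<in> carrier (diff_ring E) \<Longrightarrow> \<xi> * \<eta> \<in> carrier (diff_ring E)"
  using monoid.m_closed[OF ring.is_monoid[OF cring.axioms(1)[OF cring_diff_ring]], of \<xi> E \<eta>] by simp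

lemma power_in_diff_ring:
  assumes "\<xi> \<in> carrier (diff_ring E)"
  shows "\<xi> ^ n \<in> carrier (diff_ring E)"
proof (induction n)
  case 0
  show ?case
    using monoid.one_closed[OF ring.is_monoid[OF cring.axioms(1)[OF cring_diff_ring]], of E] by simp
qed (simp add: mult_in_diff_ring assms)

lemma alg_class_mult:
  "\<xi> \<in> carrier (diff_ring E) \<Longrightarrow> \<eta> \<in> carrier (diff_ring E) \<Longrightarrow>
    alg_class E f \<xi> \<otimes>\<^bsub>alg E f\<^esub> alg_class E f \<eta> = alg_class E f (\<xi> * \<eta>)"
  using ring_hom_mult[OF ideal.rcos_ring_hom[OF ideal_Ann[of E f]], of \<xi> \<eta>]
  by (simp add: alg_class_def alg_def)

lemma alg_class_power:
  assumes "\<xi> \<in> carrier (diff_ring E)"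
  shows "alg_class E f \<xi> [^]\<^bsub>alg E f\<^esub> n = alg_class E f (\<xi> ^ n)"
proof (induction n)
  case 0
  show ?case
    using ring_hom_one[OF ideal.rcos_ring_hom[OF ideal_Ann[of E f]]]
    by (simp add: alg_class_def alg_def nat_pow_def)
next
  case (Suc n)
  have "alg_class E f \<xi> [^]\<^bsub>alg E f\<^esub> Suc n = alg_class E f \<xi> [^]\<^bsub>alg E f\<^esub> n \<otimes>\<^bsub>alg E f\<^esub> alg_class E f \<xi>"
    by (simp add: nat_pow_def)
  then show ?case
    by (simp only: Suc.IH alg_class_mult[OF power_in_diff_ring[OF assms] assms] power_Suc2)
qed

lemma alg_class_eq_zero_iff:
  assumes "\<xi> \<in> carrier (diff_ring E)"
  shows "alg_class E f \<xi> = \<zero>\<^bsub>alg E f\<^esub> \<longleftrightarrow> diff_act \<xi> f = 0"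
proof -
  interpret ideal "Ann E f" "diff_ring E" by (rule ideal_Ann)
  have "alg_class E f \<xi> = Ann E f \<longleftrightarrow> \<xi> \<in> Ann E f"
    unfolding alg_class_def using a_rcos_self[OF assms] a_rcos_const by auto
  moreover have "\<zero>\<^bsub>alg E f\<^esub> = Ann E f"
    unfolding alg_def FactRing_def by (simp only: ring.select_convs)
  moreover have "\<xi> \<in> Ann E f \<longleftrightarrow> diff_act \<xi> f = 0"
    unfolding Ann_def using assms by blast
  ultimately show ?thesis by (simp only:)
qed

section \<open>Degree-one operators as linear forms\<close>

lemma linear_form_eq_sum_single:
  "linear_form E x = (\<Sum>i\<in>E. Poly_Mapping.single (Poly_Mapping.single i 1) (x i))"
  by (simp add: linear_form_def Const_def Var_def mult_single)

lemma lookup_linear_form: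
  "Poly_Mapping.lookup (linear_form E x) m = (\<Sum>i\<in>E. if Poly_Mapping.single i 1 = m then x i else 0)"
  by (simp add: linear_form_eq_sum_single lookup_sum lookup_single when_def)

lemma keys_linear_form:
  assumes "m \<in> Poly_Mapping.keys (linear_form E x)"
  obtains i where "i \<in> E" "m = Poly_Mapping.single i 1"
proof -
  have "(\<Sum>i\<in>E. if Poly_Mapping.single i 1 = m then x i else 0) \<noteq> 0"
    using assms by (simp add: in_keys_iff lookup_linear_form)
  then obtain i where "i \<in> E" "(if Poly_Mapping.single i 1 = m then x i else 0) \<noteq> 0"
    by (rule sum.not_neutral_contains_not_neutral)
  then show ?thesis using that by (auto split: if_splits)
qed

lemma linear_form_in_diff_ring: "linear_form E x \<in> carrier (diff_ring E)"
  by (auto simp: diff_ring_def elim!: keys_linear_form)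

lemma homogeneous_linear_form: "homogeneous 1 (linear_form E x)"
  unfolding homogeneous_def by (auto elim!: keys_linear_form)

text \<open>An exponent vector of total degree one is a unit vector. Thus every degree-one class is
  represented by a coefficient vector.\<close>

lemma homogeneous_one_eq_linear_form:
  assumes "finite E" "\<xi> \<in> carrier (diff_ring E)" "homogeneous 1 \<xi>"
  obtains x where "\<xi> = linear_form E x"
proof -
  let ?s = "\<lambda>i. Poly_Mapping.single i (1 :: nat)"
  have "m \<in> ?s ` E" if m: "m \<in> Poly_Mapping.keys \<xi>" for m
  proof -
    have sub: "Poly_Mapping.keys m \<subseteq> E" using assms(2) m by (simp add: diff_ring_def)
    have "(\<Sum>e\<in>Poly_Mapping.keys m. Poly_Mapping.lookup m e) = 1"
      using assms(3) m by (simp add: homogeneous_def)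
    then obtain i where i: "i \<in> Poly_Mapping.keys m" "Poly_Mapping.lookup m i = 1"
      "\<forall>j\<in>Poly_Mapping.keys m. i \<noteq> j \<longrightarrow> Poly_Mapping.lookup m j = 0"
      unfolding sum_eq_1_iff[OF finite_keys] by blast
    then have "m = ?s i"
      by (intro poly_mapping_eqI) (auto simp: lookup_single when_def in_keys_iff)
    then show ?thesis using i sub by blast
  qed
  moreover have "inj_on ?s E"
    by (rule inj_onI, drule arg_cong[where f = Poly_Mapping.keys]) simp
  ultimately have "\<xi> = (\<Sum>m\<in>?s ` E. Poly_Mapping.single m (Poly_Mapping.lookup \<xi> m))"
    using assms(1) by (intro poly_mapping_sum_single[symmetric]) auto
  also have "\<dots> = (\<Sum>i\<in>E. Poly_Mapping.single (?s i) (Poly_Mapping.lookup \<xi> (?s i)))"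
    by (intro sum.reindex_cong[OF \<open>inj_on ?s E\<close>]) auto
  finally show ?thesis
    using that by (simp only: linear_form_eq_sum_single)
qed

text \<open>Translates the relation from classes to representatives. With \<open>d = n + 2\<close>
  and \<open>k = 1\<close> the exponents are \<open>n\<close> and \<open>n + 1\<close>, and the sign
  \<open>(- 1) ^ k\<close> turns positivity into negativity.\<close>

lemma HRR_one_iff:
  assumes "finite E"
  shows "HRR E f (n + 2) 1 (alg_class E f (linear_form E a)) \<longleftrightarrow>
    (\<forall>x. diff_act (linear_form E x * linear_form E a ^ (n + 1)) f = 0 \<longrightarrow>
      diff_act (linear_form E x) f \<noteq> 0 \<longrightarrow>
      diff_const (linear_form E x * linear_form E x * linear_form E a ^ n) f < 0)"
proof -
  let ?h = "alg_class E f" and ?l = "linear_form E"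
  note C = linear_form_in_diff_ring mult_in_diff_ring power_in_diff_ring
  have form: "HR_form E f (n + 2) 1 (?h (?l a)) (?h (?l x)) (?h (?l x)) =
      - diff_const (?l x * ?l x * ?l a ^ n) f" for x
    by (simp add: HR_form_def alg_class_power alg_class_mult C diff_const_def alg_deg_class[where E = E])
  have prim: "X \<in> primitive_space E f (n + 2) 1 (?h (?l a)) \<longleftrightarrow>
      (\<exists>x. X = ?h (?l x) \<and> diff_act (?l x * ?l a ^ (n + 1)) f = 0)" for X
  proof -
    have comp: "X \<in> alg_comp E f 1 \<longleftrightarrow> (\<exists>x. X = ?h (?l x))"
      unfolding alg_comp_def
      using homogeneous_one_eq_linear_form[OF assms] linear_form_in_diff_ring[of E] homogeneous_linear_form[of E]
      by blast
    have zero: "?h (?l a) [^]\<^bsub>alg E f\<^esub> (n + 1) \<otimes>\<^bsub>alg E f\<^esub> ?h (?l x) = \<zero>\<^bsub>alg E f\<^esub> \<longleftrightarrow>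
        diff_act (?l x * ?l a ^ (n + 1)) f = 0" for x
      by (simp only: alg_class_power alg_class_mult C alg_class_eq_zero_iff mult.commute[of "?l x"])
    have "n + 2 - 2 * 1 + 1 = n + 1" by simp
    then show ?thesis
      unfolding primitive_space_def mem_Collect_eq comp using zero by metis
  qed
  have "HRR E f (n + 2) 1 (?h (?l a)) \<longleftrightarrow>
      (\<forall>x. diff_act (?l x * ?l a ^ (n + 1)) f = 0 \<longrightarrow> ?h (?l x) \<noteq> \<zero>\<^bsub>alg E f\<^esub> \<longrightarrow>
        0 < HR_form E f (n + 2) 1 (?h (?l a)) (?h (?l x)) (?h (?l x)))"
    unfolding HRR_def Ball_def prim by blast
  then show ?thesis
    unfolding form alg_class_eq_zero_iff[OF linear_form_in_diff_ring] by simp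
qed

theorem theorem4p5p4:
  fixes E :: "'a set" and \<I> :: "'a set set" and e :: 'a
  assumes "matroid E \<I>"
    and "matroid_rank \<I> \<ge> 2"
    and "e \<in> E"
  shows "HRR_on E (basis_gen_poly \<I>) (matroid_rank \<I>) 1 (relint_on E (orthant_facet E e))
           \<longleftrightarrow> \<not> coloop \<I> e"
proof -
  interpret matroid E \<I> by fact
  obtain n where n: "matroid_rank \<I> = n + 2"
    using assms(2) by (metis add.commute le_Suc_ex)
  have ex: "exchange_family E (n + 2) (bases \<I>)" using exchange_family_bases n by simp
  note D = exchange_familyD[OF ex]
  have HRR: "HRR_on E (basis_gen_poly \<I>) (matroid_rank \<I>) 1 (relint_on E (orthant_facet E e)) \<longleftrightarrow>
      (\<forall>a. a \<in> E \<rightarrow>\<^sub>E UNIV \<and> a e = 0 \<and> (\<forall>i\<in>E - {e}. 0 < a i) \<longrightarrow>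
        HRR E (family_poly (bases \<I>)) (n + 2) 1 (alg_class E (family_poly (bases \<I>)) (linear_form E a)))"
    by (auto simp: HRR_on_def relint_orthant_facet[OF finite_ground assms(3)] n basis_gen_poly_eq_family_poly)
  show ?thesis
  proof
    assume "\<not> coloop \<I> e"
    then obtain B where B: "B \<in> bases \<I>" "e \<notin> B" by (auto simp: coloop_def)
    have "HRR E (family_poly (bases \<I>)) (n + 2) 1 (alg_class E (family_poly (bases \<I>)) (linear_form E a))"
      if a: "a e = 0" "\<forall>i\<in>E - {e}. 0 < a i" for a
      unfolding HRR_one_iff[OF finite_ground]
    proof (intro allI impI, rule ccontr)
      fix x
      assume "diff_act (linear_form E x * linear_form E a ^ (n + 1)) (family_poly (bases \<I>)) = 0"
        and ne: "diff_act (linear_form E x) (family_poly (bases \<I>)) \<noteq> 0"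
        and "\<not> diff_const (linear_form E x * linear_form E x * linear_form E a ^ n) (family_poly (bases \<I>)) < 0"
      \<comment> \<open>A primitive vector on which the form is not negative satisfies the premises
        of \<open>hodge_riemann_strict\<close>, so its class is zero.\<close>
      then have "diff_act (linear_form E x) (family_poly (bases \<I>)) = 0"
        using a
        by (intro hodge_riemann_strict[where a = a and e = e, OF ex _ a(1) B]) (auto simp: diff_const_def)
      then show False using ne by simp
    qed
    then show "HRR_on E (basis_gen_poly \<I>) (matroid_rank \<I>) 1 (relint_on E (orthant_facet E e))"
      using HRR by blast
  next
    assume H: "HRR_on E (basis_gen_poly \<I>) (matroid_rank \<I>) 1 (relint_on E (orthant_facet E e))"
    show "\<not> coloop \<I> e"
    proof
      assume coloop: "coloop \<I> e"
      define a where "a = restrict (\<lambda>i. if i = e then 0 else 1 :: real) E"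
      have a: "a \<in> E \<rightarrow>\<^sub>E UNIV" "a e = 0" "\<forall>i\<in>E - {e}. 0 < a i"
        using assms(3) by (auto simp: a_def)
      obtain B where B: "B \<in> bases \<I>" using bases_nonempty by blast
      \<comment> \<open>Rank at least two provides a basis element \<open>i \<noteq> e\<close>; its
        derivative will violate the relation.\<close>
      have "\<not> B \<subseteq> {e}" using D(4)[OF B] card_mono[of "{e}" B] by auto
      then obtain i where i: "i \<in> B" "i \<noteq> e" by blast
      then have iE: "i \<in> E" using D(3)[OF B] by blast
      have ex': "exchange_family E (Suc (n + 1)) (bases \<I>)" "exchange_family E (Suc (Suc n)) (bases \<I>)"
        using ex by simp_all
      define x where "x = (\<lambda>j. if j = i then 1 else 0 :: real)"
      have x: "linear_form E x = Var i"
        unfolding x_def by (rule linear_form_indicator[OF finite_ground iE])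
      have act: "diff_act (Var i * \<xi>) (family_poly (bases \<I>)) = diff_act \<xi> (family_poly (contraction i (bases \<I>)))" for \<xi>
        by (simp add: diff_act_Var_mult pdiff_exchange_family[OF ex])
      \<comment> \<open>Primitivity: \<open>e\<close> lies in every member of the contraction by
        \<open>i\<close>, and \<open>a e = 0\<close>.\<close>
      have "diff_act (linear_form E x * linear_form E a ^ (n + 1)) (family_poly (bases \<I>)) = 0"
        unfolding x act
        using coloop i
        by (intro diff_act_power_eq_0[OF exchange_family_contraction[OF ex'(1)], where e = e] a)
           (auto simp: contraction_def coloop_def)
      moreover have "diff_act (linear_form E x) (family_poly (bases \<I>)) \<noteq> 0"
      proof
        assume "diff_act (linear_form E x) (family_poly (bases \<I>)) = 0"
        then have "family_poly (contraction i (bases \<I>)) = 0"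
          by (simp add: x diff_act_Var pdiff_exchange_family[OF ex])
        \<comment> \<open>Nonvanishing is detected by applying the sum of all derivatives
          repeatedly, with all weights equal to one.\<close>
        moreover have "0 < diff_const (linear_form E (\<lambda>_. 1) ^ (n + 1)) (family_poly (contraction i (bases \<I>)))"
          using B i
          by (intro diff_const_power_pos[OF exchange_family_contraction[OF ex'(1)], where B = "B - {i}"])
             (auto simp: contraction_def)
        ultimately show False by simp
      qed
      moreover have "diff_const (linear_form E x * linear_form E x * linear_form E a ^ n) (family_poly (bases \<I>)) = 0"
      proof -
        \<comment> \<open>Isotropy: the second derivative by \<open>i\<close> kills a squarefree
          polynomial.\<close>
        have "contraction i (contraction i (bases \<I>)) = {}" by (auto simp: contraction_def)
        then show ?thesis unfolding x by (simp add: diff_const_Var_Var[OF ex'(2)])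
      qed
      ultimately show False
        using H a unfolding HRR HRR_one_iff[OF finite_ground] by fastforce
    qed
  qed
qed

end
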